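(* Of the $4462$ triangulations (up to isomorphism) of the Klein bottle with exactly $10$ vertices, at least $76$ have polyhedral realizations in $\mathbb{R}^3$ which realize an involutory symmetry (a geometric symmetry of order $2$). More precisely, there are $76$ such triangulations for which: in most cases the realized symmetry is a rotation of order $2$, but in $9$ cases a reflection in a plane is realized as a geometric symmetry.
   Context: A triangulation of a closed connected surface $S$ is a finite two-dimensional simplicial complex $\Delta$ whose underlying space $|\Delta|$ is homeomorphic to $S$; triangulations are counted up to combinatorial (simplicial) isomorphism. The Klein bottle has exactly $4462$ triangulations with $10$ vertices, from the known enumeration. "Most" means more than half. Let $V$ be the vertex set of $\Delta$. Each map $\psi\colon V\to\mathbb{R}^3$ induces a simplexwise linear map $\phi_\psi\colon|\Delta|\to\mathbb{R}^3$. Since the surface is non-orientable, a polyhedral realization of $\Delta$ in $\mathbb{R}^3$ is a map $\phi_\psi$ that is locally injective (a simplexwise linear immersion). A geometric symmetry of a polyhedral realization $\phi_\psi$ is an isometry $g$ of $\mathbb{R}^3$ that maps $\phi_\psi(|\Delta|)$ to itself and is induced by an automorphism $\alpha$ of $\Delta$, i.e. $g\circ\phi_\psi=\phi_\psi\circ|\alpha|$. Symmetries considered here are induced by nontrivial automorphisms. *)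

theory Defs
  imports "HOL-Analysis.Analysis"
begin

section \<open>The Klein bottle\<close>

definition quotient_topology :: "'a topology \<Rightarrow> ('a \<Rightarrow> 'b) \<Rightarrow> 'b topology" where
  "quotient_topology X f =
     topology (\<lambda>U. U \<subseteq> f ` topspace X \<and> openin X {x \<in> topspace X. f x \<in> U})"

lemma openin_quotient_topology:
  "openin (quotient_topology X f) U \<longleftrightarrow>
     U \<subseteq> f ` topspace X \<and> openin X {x \<in> topspace X. f x \<in> U}"
proof -
  have "istopology (\<lambda>U. U \<subseteq> f ` topspace X \<and> openin X {x \<in> topspace X. f x \<in> U})"
    unfolding istopology_def
  proof (intro conjI allI impI, goal_cases)
    case (1 S T)
    then show ?case by blast
  next
    case (2 S T)
    have "{x \<in> topspace X. f x \<in> S \<inter> T} =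
          {x \<in> topspace X. f x \<in> S} \<inter> {x \<in> topspace X. f x \<in> T}"
      by blast
    with 2 show ?case by auto
  next
    case (3 \<K>)
    then show ?case by blast
  next
    case (4 \<K>)
    have "{x \<in> topspace X. f x \<in> \<Union>\<K>} = (\<Union>U\<in>\<K>. {x \<in> topspace X. f x \<in> U})"
      by blast
    with 4 show ?case by auto
  qed
  then show ?thesis
    by (simp add: quotient_topology_def)
qed

lemma topspace_quotient_topology: "topspace (quotient_topology X f) = f ` topspace X"
proof (rule subset_antisym)
  show "topspace (quotient_topology X f) \<subseteq> f ` topspace X"
    using openin_topspace[of "quotient_topology X f"]
    unfolding openin_quotient_topology by blast
  have "{x \<in> topspace X. f x \<in> f ` topspace X} = topspace X" by blast
  then have "openin (quotient_topology X f) (f ` topspace X)"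
    by (simp add: openin_quotient_topology)
  then show "f ` topspace X \<subseteq> topspace (quotient_topology X f)"
    by (rule openin_subset)
qed

lemma quotient_map_quotient_topology: "quotient_map X (quotient_topology X f) f"
  by (auto simp: quotient_map_def topspace_quotient_topology openin_quotient_topology)

definition unit_square :: "(real \<times> real) set" where
  "unit_square = {0..1} \<times> {0..1}"

text \<open>Horizontal sides are glued preserving, vertical sides reversing the orientation.\<close>
definition klein_gluing :: "((real \<times> real) \<times> (real \<times> real)) set" where
  "klein_gluing = {((s, 0), (s, 1)) | s. s \<in> {0..1}} \<union> {((0, t), (1, 1 - t)) | t. t \<in> {0..1}}"

definition klein_rel :: "((real \<times> real) \<times> (real \<times> real)) set" where
  "klein_rel = (klein_gluing \<union> klein_gluing\<inverse>)\<^sup>*"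

definition klein_bottle :: "(real \<times> real) set topology" where
  "klein_bottle = quotient_topology (top_of_set unit_square) (\<lambda>p. klein_rel `` {p})"


section \<open>Abstract simplicial complexes and triangulations\<close>

text \<open>A complex is given by its nonempty simplices, each simplex being its set of vertices.\<close>

definition simplicial_cplx :: "nat set set \<Rightarrow> bool" where
  "simplicial_cplx K \<longleftrightarrow> finite K \<and>
     (\<forall>\<sigma>\<in>K. finite \<sigma> \<and> \<sigma> \<noteq> {}) \<and>
     (\<forall>\<sigma>\<in>K. \<forall>\<tau>. \<tau> \<subseteq> \<sigma> \<and> \<tau> \<noteq> {} \<longrightarrow> \<tau> \<in> K)"

definition two_dimensional :: "nat set set \<Rightarrow> bool" where
  "two_dimensional K \<longleftrightarrow> (\<forall>\<sigma>\<in>K. card \<sigma> \<le> 3) \<and> (\<exists>\<sigma>\<in>K. card \<sigma> = 3)"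

definition verts :: "nat set set \<Rightarrow> nat set" where
  "verts K = \<Union>K"

text \<open>
  The underlying space: points are barycentric coordinate functions supported on a simplex.
  For a finite complex the subspace topology inherited from the product topology on
  \<^typ>\<open>nat \<Rightarrow> real\<close> is the usual one.
\<close>
definition space_of :: "nat set set \<Rightarrow> (nat \<Rightarrow> real) set" where
  "space_of K = {x. (\<forall>v. 0 \<le> x v) \<and>
     (\<exists>\<sigma>\<in>K. (\<forall>v. v \<notin> \<sigma> \<longrightarrow> x v = 0) \<and> (\<Sum>v\<in>\<sigma>. x v) = 1)}"

definition triangulation_of :: "'a topology \<Rightarrow> nat set set \<Rightarrow> bool" where
  "triangulation_of S K \<longleftrightarrow> simplicial_cplx K \<and> two_dimensional K \<and>
     top_of_set (space_of K) homeomorphic_space S"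

definition simplicial_iso :: "(nat \<Rightarrow> nat) \<Rightarrow> nat set set \<Rightarrow> nat set set \<Rightarrow> bool" where
  "simplicial_iso f K L \<longleftrightarrow> bij_betw f (verts K) (verts L) \<and> (\<lambda>\<sigma>. f ` \<sigma>) ` K = L"

definition triangulations :: "'a topology \<Rightarrow> nat \<Rightarrow> nat set set set" where
  "triangulations S n = {K. triangulation_of S K \<and> card (verts K) = n}"

text \<open>Triangulations up to combinatorial isomorphism.\<close>
definition triangulation_classes :: "'a topology \<Rightarrow> nat \<Rightarrow> nat set set set set" where
  "triangulation_classes S n = triangulations S n //
     {(K, L). K \<in> triangulations S n \<and> L \<in> triangulations S n \<and> (\<exists>f. simplicial_iso f K L)}"


section \<open>Polyhedral realizations and geometric symmetries\<close>

definition simplexwise_linear :: "nat set set \<Rightarrow> (nat \<Rightarrow> real^3) \<Rightarrow> (nat \<Rightarrow> real) \<Rightarrow> real^3" where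
  "simplexwise_linear K \<psi> x = (\<Sum>v\<in>verts K. x v *\<^sub>R \<psi> v)"

text \<open>Realizations of non-orientable surfaces: simplexwise linear immersions, not embeddings.\<close>
definition polyhedral_realization :: "nat set set \<Rightarrow> (nat \<Rightarrow> real^3) \<Rightarrow> bool" where
  "polyhedral_realization K \<psi> \<longleftrightarrow>
     (\<forall>x\<in>space_of K. \<exists>U. openin (top_of_set (space_of K)) U \<and> x \<in> U \<and>
        inj_on (simplexwise_linear K \<psi>) U)"

definition automorphism :: "nat set set \<Rightarrow> (nat \<Rightarrow> nat) \<Rightarrow> bool" where
  "automorphism K \<alpha> \<longleftrightarrow> simplicial_iso \<alpha> K K"

definition induced_map :: "nat set set \<Rightarrow> (nat \<Rightarrow> nat) \<Rightarrow> (nat \<Rightarrow> real) \<Rightarrow> (nat \<Rightarrow> real)" where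
  "induced_map K \<alpha> x = (\<lambda>w. \<Sum>v\<in>{v \<in> verts K. \<alpha> v = w}. x v)"

definition geometric_symmetry ::
    "nat set set \<Rightarrow> (nat \<Rightarrow> real^3) \<Rightarrow> (real^3 \<Rightarrow> real^3) \<Rightarrow> bool" where
  "geometric_symmetry K \<psi> g \<longleftrightarrow>
     (\<forall>x y. dist (g x) (g y) = dist x y) \<and>
     g ` simplexwise_linear K \<psi> ` space_of K = simplexwise_linear K \<psi> ` space_of K \<and>
     (\<exists>\<alpha>. automorphism K \<alpha> \<and> (\<exists>v\<in>verts K. \<alpha> v \<noteq> v) \<and>
        (\<forall>x\<in>space_of K. g (simplexwise_linear K \<psi> x) =
                         simplexwise_linear K \<psi> (induced_map K \<alpha> x)))"

definition involutory :: "(real^3 \<Rightarrow> real^3) \<Rightarrow> bool" where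
  "involutory g \<longleftrightarrow> g \<noteq> id \<and> g \<circ> g = id"

definition rotation :: "(real^3 \<Rightarrow> real^3) \<Rightarrow> bool" where
  "rotation g \<longleftrightarrow> (\<exists>p A. rotation_matrix A \<and> g = (\<lambda>x. p + A *v (x - p)))"

text \<open>Reflection in the plane of all \<open>x\<close> with \<open>u \<bullet> x = b\<close>.\<close>
definition plane_reflection :: "(real^3 \<Rightarrow> real^3) \<Rightarrow> bool" where
  "plane_reflection g \<longleftrightarrow> (\<exists>u b. norm u = 1 \<and> g = (\<lambda>x. x - (2 * (u \<bullet> x - b)) *\<^sub>R u))"

text \<open>
  For an isomorphism class of triangulations; the choice of the representative is immaterial.
\<close>
definition realizes_symmetry :: "nat set set set \<Rightarrow> (real^3 \<Rightarrow> real^3) \<Rightarrow> bool" where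
  "realizes_symmetry c g \<longleftrightarrow>
     (\<exists>K\<in>c. \<exists>\<psi>. polyhedral_realization K \<psi> \<and> geometric_symmetry K \<psi> g)"

end

theory Submission
  imports Defs
begin

text \<open>
  All triangulations used here are obtained from one explicit Klein bottle by edge flips. If the
  triangles \<open>abc, abd\<close> are replaced by \<open>acd, bcd\<close>, then in barycentric coordinates the map that adds
  \<open>min(x\<^sub>a, x\<^sub>b)\<close> to \<open>x\<^sub>c\<close> and \<open>x\<^sub>d\<close> and subtracts it from \<open>x\<^sub>a\<close> and \<open>x\<^sub>b\<close> is a homeomorphism, whose inverse
  has the same form. The initial surface is the square cut into a 3 by 3 grid with diagonals: hat
  functions at the grid points map the square onto it with the fibres of the Klein bottle gluing.
  Starring a triangle supplies the tenth vertex.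

  A simplexwise linear map is locally injective if it embeds all vertex stars. This is a condition
  on pairs of triangles at a vertex, and it follows from the signs of determinants of the integral
  vertex coordinates. These coordinates were found by a random search among those that are
  invariant under the reflection \<open>(-x, y, z)\<close> (9 surfaces) or the half-turn \<open>(-x, -y, z)\<close> (67 surfaces).

  The triangulations are pairwise non-isomorphic because one invariant separates them: the sum
  of the products of all vertex degrees of \<open>t\<close> and of \<open>s\<close> over the ordered pairs of triangles \<open>t, s\<close>
  that share an edge.
\<close>

section \<open>Complexes generated by triangles, and bistellar moves\<close>

text \<open>The goal asks for homeomorphisms with a concrete quotient of the square. Euler
  characteristic and orientability would settle this only through the classification of surfaces; so
  just one complex is compared with the square, and a successful run of flips is the certificate for
  each of the others. Flips keep the vertex set, so the tenth vertex has to be present before the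
  first flip. A grid of width 3 is the smallest choice: the grid lines that close up must be
  simplicial circles and so need three vertices. Seen from a vertex, the image of its star is part
  of a cone, and injectivity on a cone does not depend on lengths. This is why signs of determinants
  suffice and no inequality between sizes occurs. Degenerate positions, with some determinants 0,
  are still accepted as long as one separating plane through the vertex is found. The exact number 9
  of reflections is obtained by choosing one symmetry for each class and by the fact that a
  half-turn is not a plane reflection.\<close>

definition triangle_set :: "nat set set \<Rightarrow> bool" where
  "triangle_set F \<longleftrightarrow> finite F \<and> F \<noteq> {} \<and> (\<forall>t\<in>F. card t = 3)"

definition generated :: "nat set set \<Rightarrow> nat set set" where
  "generated F = {\<sigma>. \<sigma> \<noteq> {} \<and> (\<exists>t\<in>F. \<sigma> \<subseteq> t)}"

definition realization :: "nat set set \<Rightarrow> (nat \<Rightarrow> real) set" where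
  "realization F = {x. (\<forall>v. 0 \<le> x v) \<and> (\<exists>t\<in>F. (\<forall>v. v \<notin> t \<longrightarrow> x v = 0) \<and> sum x t = 1)}"

lemma realizationI:
  "t \<in> F \<Longrightarrow> (\<And>v. 0 \<le> x v) \<Longrightarrow> (\<And>v. v \<notin> t \<Longrightarrow> x v = 0) \<Longrightarrow> sum x t = 1 \<Longrightarrow> x \<in> realization F"
  by (auto simp: realization_def)

lemma triangle_setD:
  assumes "triangle_set F" "t \<in> F"
  shows "card t = 3" "finite t" "t \<noteq> {}"
proof -
  show "card t = 3" using assms by (simp add: triangle_set_def)
  then show "finite t" using card.infinite by fastforce
  show "t \<noteq> {}" using \<open>card t = 3\<close> by auto
qed

lemma verts_generated: "verts (generated F) = \<Union>F"
  unfolding verts_def generated_def by auto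

lemma simplicial_cplx_generated:
  assumes "triangle_set F"
  shows "simplicial_cplx (generated F)"
proof -
  have "generated F \<subseteq> Pow (\<Union>F)" unfolding generated_def by auto
  moreover have "finite (\<Union>F)"
    using assms triangle_setD(2)[OF assms] by (auto simp: triangle_set_def)
  ultimately have "finite (generated F)" by (meson finite_Pow_iff finite_subset)
  moreover have "finite \<sigma>" if "\<sigma> \<in> generated F" for \<sigma>
    using that triangle_setD(2)[OF assms] unfolding generated_def by (auto intro: finite_subset)
  ultimately show ?thesis unfolding simplicial_cplx_def by (auto simp: generated_def dest: order_trans)
qed

lemma two_dimensional_generated:
  assumes "triangle_set F"
  shows "two_dimensional (generated F)"
proof -
  have "card \<sigma> \<le> 3" if "\<sigma> \<in> generated F" for \<sigma>
    using that triangle_setD[OF assms] unfolding generated_def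
    by clarsimp (metis card_mono)
  moreover obtain t where "t \<in> F" using assms by (auto simp: triangle_set_def)
  ultimately show ?thesis using triangle_setD[OF assms \<open>t \<in> F\<close>]
    unfolding two_dimensional_def generated_def by blast
qed

text \<open>A generated complex remembers its triangles, so an isomorphism of complexes can be read
  as a bijection between triangle sets.\<close>

lemma facets_generated:
  assumes "triangle_set F"
  shows "{\<sigma> \<in> generated F. card \<sigma> = 3} = F"
proof (intro subset_antisym subsetI)
  fix \<sigma> assume "\<sigma> \<in> {\<sigma> \<in> generated F. card \<sigma> = 3}"
  then obtain t where "t \<in> F" "\<sigma> \<subseteq> t" "card \<sigma> = 3" by (auto simp: generated_def)
  then have "\<sigma> = t" using triangle_setD[OF assms \<open>t \<in> F\<close>] by (metis card_subset_eq)
  with \<open>t \<in> F\<close> show "\<sigma> \<in> F" by simp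
next
  fix t assume "t \<in> F"
  with triangle_setD[OF assms this] show "t \<in> {\<sigma> \<in> generated F. card \<sigma> = 3}"
    by (auto simp: generated_def)
qed

lemma space_of_generated:
  assumes "triangle_set F"
  shows "space_of (generated F) = realization F"
proof (intro subset_antisym subsetI)
  fix x assume "x \<in> space_of (generated F)"
  then obtain \<sigma> t where x: "\<forall>v. 0 \<le> x v" "\<forall>v. v \<notin> \<sigma> \<longrightarrow> x v = 0" "sum x \<sigma> = 1"
    and t: "t \<in> F" "\<sigma> \<subseteq> t"
    by (auto simp: space_of_def generated_def)
  have "sum x t = sum x \<sigma>"
    using t x triangle_setD(2)[OF assms] by (intro sum.mono_neutral_right) auto
  with x t show "x \<in> realization F" by (auto simp: realization_def)
next
  fix x assume "x \<in> realization F"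
  then show "x \<in> space_of (generated F)"
    using triangle_setD(3)[OF assms] unfolding realization_def space_of_def generated_def
    by blast
qed

lemma triangulation_of_generated:
  assumes "triangle_set F" "top_of_set (realization F) homeomorphic_space S"
  shows "triangulation_of S (generated F)"
  using assms simplicial_cplx_generated two_dimensional_generated space_of_generated
  by (simp add: triangulation_of_def)

section \<open>Edge flips as homeomorphisms\<close>

lemma homeomorphic_spaceI:
  fixes S :: "'a::topological_space set" and T :: "'b::topological_space set"
  assumes "continuous_on S f" "continuous_on T g"
    and "\<And>x. x \<in> S \<Longrightarrow> f x \<in> T \<and> g (f x) = x"
    and "\<And>y. y \<in> T \<Longrightarrow> g y \<in> S \<and> f (g y) = y"
  shows "top_of_set S homeomorphic_space top_of_set T"
proof (rule homeomorphic_maps_imp_homeomorphic_space)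
  show "homeomorphic_maps (top_of_set S) (top_of_set T) f g"
    using assms by (auto simp: homeomorphic_maps_def continuous_map_in_subtopology)
qed

lemma continuous_on_coordinate: "continuous_on S (\<lambda>x. x i :: real)"
  by (rule continuous_on_subset[OF continuous_on_product_coordinates]) simp

definition flip_map :: "nat \<Rightarrow> nat \<Rightarrow> nat \<Rightarrow> nat \<Rightarrow> (nat \<Rightarrow> real) \<Rightarrow> nat \<Rightarrow> real" where
  "flip_map a b c d x v =
     x v + min (x a) (x b) * (if v = a \<or> v = b then -1 else if v = c \<or> v = d then 1 else 0)"

lemma continuous_flip_map: "continuous_on S (flip_map a b c d)"
  unfolding flip_map_def[abs_def]
  by (intro continuous_on_coordinatewise_then_product continuous_intros continuous_on_coordinate)

text \<open>On a triangle at the edge \<open>ab\<close>, the smaller of the coordinates at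
  \<open>a\<close> and \<open>b\<close> becomes 0, so the image lies in a triangle at
  \<open>cd\<close>. The amount moved reappears as the minimum at \<open>c\<close> and
  \<open>d\<close>, hence the map with the two pairs exchanged undoes it. On all other triangles
  both minima are 0. Leaving \<open>F'\<close> general lets the lemma serve both directions.\<close>

lemma flip_map_realization:
  assumes x: "x \<in> realization F" and F: "triangle_set F" and ne: "distinct [a, b, c, d]"
    and ab: "\<And>t. t \<in> F \<Longrightarrow> a \<in> t \<Longrightarrow> b \<in> t \<Longrightarrow> t = {a, b, c} \<or> t = {a, b, d}"
    and cd: "\<And>t. t \<in> F \<Longrightarrow> c \<in> t \<Longrightarrow> d \<notin> t"
    and F': "F - {{a, b, c}, {a, b, d}} \<subseteq> F'" "{c, d, a} \<in> F'" "{c, d, b} \<in> F'"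
  shows "flip_map a b c d x \<in> realization F' \<and> flip_map c d a b (flip_map a b c d x) = x"
proof -
  obtain t where t: "t \<in> F" and x0: "\<And>v. 0 \<le> x v" and xt: "\<And>v. v \<notin> t \<Longrightarrow> x v = 0" and "sum x t = 1"
    using x by (auto simp: realization_def)
  \<comment> \<open>\<open>p\<close> is the third vertex of the triangle of \<open>x\<close> and
    \<open>q\<close> the vertex across the edge; the map is symmetric in \<open>c\<close> and
    \<open>d\<close>.\<close>
  have inner: "flip_map a b p q x \<in> realization F' \<and> flip_map p q a b (flip_map a b p q x) = x"
    if "t = {a, b, p}" and p: "p = c \<and> q = d \<or> p = d \<and> q = c" for p q
  proof -
    have dist: "a \<noteq> b" "a \<noteq> p" "a \<noteq> q" "b \<noteq> p" "b \<noteq> q" "p \<noteq> q" using ne p by auto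
    have xq: "x q = 0" using xt \<open>t = {a, b, p}\<close> dist by auto
    have sum1: "x a + x b + x p = 1" using \<open>sum x t = 1\<close> \<open>t = {a, b, p}\<close> dist by (simp add: add.assoc)
    define m where "m = min (x a) (x b)"
    have m: "0 \<le> m" "m \<le> x a" "m \<le> x b" using x0 by (auto simp: m_def)
    have st: "flip_map a b p q x = x(a := x a - m, b := x b - m, p := x p + m, q := m)"
      using dist xq by (auto simp: flip_map_def m_def fun_eq_iff)
    have "min (flip_map a b p q x p) (flip_map a b p q x q) = m"
      using dist x0[of p] by (simp add: st)
    then have inv: "flip_map p q a b (flip_map a b p q x) = x"
      using dist xq by (auto simp: flip_map_def[of p q a b] fun_eq_iff) (auto simp: st)
    have pos: "0 \<le> flip_map a b p q x v" for v using m x0[of v] x0[of p] by (simp add: st)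
    have F'pq: "{p, q, a} \<in> F'" "{p, q, b} \<in> F'" using F' p by (auto simp: insert_commute)
    have "flip_map a b p q x \<in> realization F'"
    proof (cases "x a \<le> x b")
      case True
      then have "m = x a" by (simp add: m_def)
      show ?thesis
      proof (rule realizationI[OF F'pq(2) pos])
        show "sum (flip_map a b p q x) {p, q, b} = 1"
          using dist sum1 \<open>m = x a\<close> by (simp add: st)
        show "flip_map a b p q x v = 0" if "v \<notin> {p, q, b}" for v
          using that \<open>m = x a\<close> xt[of v] \<open>t = {a, b, p}\<close> by (auto simp: st)
      qed
    next
      case False
      then have "m = x b" by (simp add: m_def)
      show ?thesis
      proof (rule realizationI[OF F'pq(1) pos])
        show "sum (flip_map a b p q x) {p, q, a} = 1"
          using dist sum1 \<open>m = x b\<close> by (simp add: st)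
        show "flip_map a b p q x v = 0" if "v \<notin> {p, q, a}" for v
          using that \<open>m = x b\<close> xt[of v] \<open>t = {a, b, p}\<close> by (auto simp: st)
      qed
    qed
    with inv show ?thesis by blast
  qed
  have comm: "flip_map a b d c = flip_map a b c d" "flip_map d c a b = flip_map c d a b"
    by (auto simp: flip_map_def fun_eq_iff min.commute)
  consider "t = {a, b, c}" | "t = {a, b, d}" | "a \<notin> t \<or> b \<notin> t" "t \<noteq> {a, b, c}" "t \<noteq> {a, b, d}"
    using ab[OF t] by blast
  then show ?thesis
  proof cases
    case 1
    then show ?thesis using inner by blast
  next
    case 2
    then show ?thesis using inner[of d c] comm by simp
  next
    case 3
    have "min (x a) (x b) = 0" using 3 xt[of a] xt[of b] x0[of a] x0[of b] by (auto simp: min_def)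
    then have "flip_map a b c d x = x" by (auto simp: flip_map_def fun_eq_iff)
    moreover have "x c = 0 \<or> x d = 0" using cd[OF t] xt by blast
    then have "min (x c) (x d) = 0" using x0[of c] x0[of d] by (auto simp: min_def)
    then have "flip_map c d a b x = x" by (auto simp: flip_map_def fun_eq_iff)
    moreover have "t \<in> F'" using 3 t F'(1) by auto
    then have "x \<in> realization F'" using x0 xt \<open>sum x t = 1\<close> by (rule realizationI)
    ultimately show ?thesis by simp
  qed
qed

lemma triangle_set_flip:
  assumes "triangle_set F" "distinct [a, b, c, d]"
  shows "triangle_set (F - {{a, b, c}, {a, b, d}} \<union> {{a, c, d}, {b, c, d}})"
  using assms unfolding triangle_set_def by auto

lemma flip_homeomorphic:
  assumes F: "triangle_set F" and ne: "distinct [a, b, c, d]"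
    and abF: "{a, b, c} \<in> F" "{a, b, d} \<in> F"
    and ab: "\<And>t. t \<in> F \<Longrightarrow> a \<in> t \<Longrightarrow> b \<in> t \<Longrightarrow> t = {a, b, c} \<or> t = {a, b, d}"
    and cd: "\<And>t. t \<in> F \<Longrightarrow> c \<in> t \<Longrightarrow> d \<notin> t"
  shows "top_of_set (realization (F - {{a, b, c}, {a, b, d}} \<union> {{a, c, d}, {b, c, d}}))
           homeomorphic_space top_of_set (realization F)"
proof -
  let ?F' = "F - {{a, b, c}, {a, b, d}} \<union> {{a, c, d}, {b, c, d}}"
  note F' = triangle_set_flip[OF F ne]
  have ne': "distinct [c, d, a, b]" using ne by auto
  show ?thesis
  proof (rule homeomorphic_spaceI[OF continuous_flip_map continuous_flip_map])
    fix x assume "x \<in> realization ?F'"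
    then show "flip_map c d a b x \<in> realization F \<and> flip_map a b c d (flip_map c d a b x) = x"
    proof (rule flip_map_realization[OF _ F' ne'])
      fix t assume t: "t \<in> ?F'"
      show "c \<in> t \<Longrightarrow> d \<in> t \<Longrightarrow> t = {c, d, a} \<or> t = {c, d, b}" using t cd by auto
      show "a \<in> t \<Longrightarrow> b \<notin> t" using t ab ne by auto
    qed (use abF in auto)
  next
    fix x assume "x \<in> realization F"
    then show "flip_map a b c d x \<in> realization ?F' \<and> flip_map c d a b (flip_map a b c d x) = x"
      by (rule flip_map_realization[OF _ F ne ab cd]) (auto simp: insert_commute)
  qed
qed

section \<open>Starring a triangle\<close>

definition star_map :: "nat \<Rightarrow> nat \<Rightarrow> nat \<Rightarrow> nat \<Rightarrow> (nat \<Rightarrow> real) \<Rightarrow> nat \<Rightarrow> real" where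
  "star_map a b c d x v = x v + min (x a) (min (x b) (x c)) *
     (if v = a \<or> v = b \<or> v = c then -1 else if v = d then 3 else 0)"

definition unstar_map :: "nat \<Rightarrow> nat \<Rightarrow> nat \<Rightarrow> nat \<Rightarrow> (nat \<Rightarrow> real) \<Rightarrow> nat \<Rightarrow> real" where
  "unstar_map a b c d x v =
     x v + x d * (if v = a \<or> v = b \<or> v = c then 1/3 else if v = d then -1 else 0)"

text \<open>\<open>d\<close> takes the place of the barycentre of \<open>abc\<close>. Three
  coordinates lose their common minimum, whence the factor 3 at \<open>d\<close>, and one of them
  becomes 0. Conversely, no new triangle contains all of \<open>a\<close>, \<open>b\<close>,
  \<open>c\<close>; after a third of the weight of \<open>d\<close> has been returned to each, the
  minimum is exactly that third.\<close>

lemma star_homeomorphic: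
  assumes F: "triangle_set F" and ne: "distinct [a, b, c, d]"
    and abc: "{a, b, c} \<in> F" and d: "d \<notin> \<Union>F"
  shows "top_of_set (realization (F - {{a, b, c}} \<union> {{a, b, d}, {b, c, d}, {a, c, d}}))
           homeomorphic_space top_of_set (realization F)"
    (is "top_of_set (realization ?F') homeomorphic_space _")
proof (rule homeomorphic_spaceI)
  show "continuous_on (realization F) (star_map a b c d)"
    unfolding star_map_def[abs_def]
    by (intro continuous_on_coordinatewise_then_product continuous_intros continuous_on_coordinate)
  show "continuous_on (realization ?F') (unstar_map a b c d)"
    unfolding unstar_map_def[abs_def]
    by (intro continuous_on_coordinatewise_then_product continuous_intros continuous_on_coordinate)
next
  fix x assume "x \<in> realization F"
  then obtain t where t: "t \<in> F" and x0: "\<And>v. 0 \<le> x v" and xt: "\<And>v. v \<notin> t \<Longrightarrow> x v = 0" and "sum x t = 1"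
    by (auto simp: realization_def)
  have xd: "x d = 0" using d t xt by auto
  define m where "m = min (x a) (min (x b) (x c))"
  have st: "star_map a b c d x = x(a := x a - m, b := x b - m, c := x c - m, d := 3 * m)"
    using ne xd by (auto simp: star_map_def m_def fun_eq_iff)
  have inv: "unstar_map a b c d (star_map a b c d x) = x"
    using ne xd by (auto simp: unstar_map_def fun_eq_iff st)
  have "star_map a b c d x \<in> realization ?F'"
  proof (cases "t = {a, b, c}")
    case True
    have sum1: "x a + x b + x c = 1" using \<open>sum x t = 1\<close> True ne by (simp add: add.assoc)
    have m: "0 \<le> m" "m \<le> x a" "m \<le> x b" "m \<le> x c" "m = x a \<or> m = x b \<or> m = x c"
      using x0 by (auto simp: m_def)
    have pos: "0 \<le> star_map a b c d x v" for v using m x0 by (simp add: st)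
    consider "m = x c" | "m = x a" | "m = x b" using m by blast
    then show ?thesis
    proof cases
      case 1
      show ?thesis
      proof (rule realizationI[of "{a, b, d}", OF _ pos])
        show "sum (star_map a b c d x) {a, b, d} = 1" using ne sum1 1 by (simp add: st)
        show "star_map a b c d x v = 0" if "v \<notin> {a, b, d}" for v
          using that 1 xt[of v] True by (auto simp: st)
      qed simp
    next
      case 2
      show ?thesis
      proof (rule realizationI[of "{b, c, d}", OF _ pos])
        show "sum (star_map a b c d x) {b, c, d} = 1" using ne sum1 2 by (simp add: st)
        show "star_map a b c d x v = 0" if "v \<notin> {b, c, d}" for v
          using that 2 xt[of v] True by (auto simp: st)
      qed simp
    next
      case 3
      show ?thesis
      proof (rule realizationI[of "{a, c, d}", OF _ pos])
        show "sum (star_map a b c d x) {a, c, d} = 1" using ne sum1 3 by (simp add: st)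
        show "star_map a b c d x v = 0" if "v \<notin> {a, c, d}" for v
          using that 3 xt[of v] True by (auto simp: st)
      qed simp
    qed
  next
    case False
    have "\<not> {a, b, c} \<subseteq> t"
      using False card_subset_eq[of t "{a, b, c}"] triangle_setD[OF F t] triangle_setD[OF F abc] by auto
    then have "x a = 0 \<or> x b = 0 \<or> x c = 0" using xt by auto
    then have "min (x a) (min (x b) (x c)) = 0" using x0[of a] x0[of b] x0[of c] by (auto simp: min_def)
    then have "star_map a b c d x = x" by (auto simp: star_map_def fun_eq_iff)
    moreover have "x \<in> realization ?F'"
      by (rule realizationI[of t]) (use False t x0 xt \<open>sum x t = 1\<close> in auto)
    ultimately show ?thesis by simp
  qed
  with inv show "star_map a b c d x \<in> realization ?F' \<and> unstar_map a b c d (star_map a b c d x) = x"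
    by blast
next
  fix x assume "x \<in> realization ?F'"
  then obtain t where t: "t \<in> ?F'" and x0: "\<And>v. 0 \<le> x v" and xt: "\<And>v. v \<notin> t \<Longrightarrow> x v = 0" and "sum x t = 1"
    unfolding realization_def by blast
  have us: "unstar_map a b c d x = x(a := x a + x d / 3, b := x b + x d / 3, c := x c + x d / 3, d := 0)"
    using ne by (auto simp: unstar_map_def fun_eq_iff)
  have "\<not> {a, b, c} \<subseteq> t"
  proof
    assume sub: "{a, b, c} \<subseteq> t"
    then have "t \<in> F" using t ne by auto
    then have "{a, b, c} = t"
      using card_subset_eq[OF _ sub] triangle_setD[OF F \<open>t \<in> F\<close>] triangle_setD[OF F abc] by auto
    then have "t \<notin> F - {{a, b, c}}" by auto
    then show False using t sub ne by auto
  qed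
  then have "x a = 0 \<or> x b = 0 \<or> x c = 0" using xt by auto
  then have m: "min (unstar_map a b c d x a) (min (unstar_map a b c d x b) (unstar_map a b c d x c)) = x d / 3"
    using ne x0[of a] x0[of b] x0[of c] by (auto simp: us min_def)
  have inv: "star_map a b c d (unstar_map a b c d x) = x"
    using ne by (auto simp: fun_eq_iff star_map_def[of a b c d "unstar_map a b c d x"] m) (auto simp: us)
  have pos: "0 \<le> unstar_map a b c d x v" for v using x0 by (simp add: us)
  have "unstar_map a b c d x \<in> realization F"
  proof (cases "t \<in> F")
    case True
    then have "x d = 0" using d xt by auto
    then have "unstar_map a b c d x = x" by (simp add: us fun_eq_iff)
    moreover have "x \<in> realization F" using True x0 xt \<open>sum x t = 1\<close> by (rule realizationI)
    ultimately show ?thesis by simp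
  next
    case False
    then have tt: "t = {a, b, d} \<or> t = {b, c, d} \<or> t = {a, c, d}" using t by auto
    have "sum x {a, b, c, d} = sum x t"
      using tt xt by (intro sum.mono_neutral_right) auto
    then have "x a + x b + x c + x d = 1" using \<open>sum x t = 1\<close> ne by (simp add: add.assoc)
    then have "sum (unstar_map a b c d x) {a, b, c} = 1" using ne by (simp add: us)
    moreover have "unstar_map a b c d x v = 0" if "v \<notin> {a, b, c}" for v
      using that xt[of v] tt by (auto simp: us)
    ultimately show ?thesis using pos by (intro realizationI[OF abc]) auto
  qed
  with inv show "unstar_map a b c d x \<in> realization F \<and> star_map a b c d (unstar_map a b c d x) = x"
    by blast
qed

section \<open>A nine-vertex Klein bottle\<close>

text \<open>
  The hat function at the origin for the triangulation of the plane by the unit squares and their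
  diagonals in direction \<open>(1, 1)\<close>.
\<close>
definition hat :: "real \<Rightarrow> real \<Rightarrow> real" where
  "hat x y = max 0 (1 - max \<bar>x\<bar> (max \<bar>y\<bar> \<bar>x - y\<bar>))"

text \<open>
  Labels of the grid points \<open>(i, j)\<close> with \<open>i, j \<le> 3\<close>: rows 0 and 3 agree, and column 3 is column 0
  upside down.
\<close>
definition grid_label :: "nat \<Rightarrow> nat \<Rightarrow> nat" where
  "grid_label i j = (if i = 3 then (3 - j) mod 3 else 3 * i + j mod 3)"

definition grid_triangles :: "nat set set" where
  "grid_triangles =
     (\<lambda>(i, j). {grid_label i j, grid_label (i + 1) j, grid_label (i + 1) (j + 1)}) ` ({..<3} \<times> {..<3}) \<union>
     (\<lambda>(i, j). {grid_label i j, grid_label i (j + 1), grid_label (i + 1) (j + 1)}) ` ({..<3} \<times> {..<3})"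

definition grid_map :: "real \<times> real \<Rightarrow> nat \<Rightarrow> real" where
  "grid_map p v = (\<Sum>i\<le>3. \<Sum>j\<le>3.
     if grid_label i j = v then hat (3 * fst p - real i) (3 * snd p - real j) else 0)"

text \<open>On each half of a cell the hat functions at the three corners are barycentric
  coordinates. Relative to any other grid point, including the fourth corner, one of
  \<open>x\<close>, \<open>y\<close>, \<open>x - y\<close> has absolute value at least 1.\<close>

lemma hat_grid:
  fixes i j k l :: nat
  assumes "0 \<le> b" "0 \<le> c" "b + c \<le> 1"
  shows "hat (real i + (b + c) - real k) (real j + c - real l) =
     (if k = i \<and> l = j then 1 - b - c else if k = i + 1 \<and> l = j then b
      else if k = i + 1 \<and> l = j + 1 then c else 0)"
    and "hat (real i + c - real k) (real j + (b + c) - real l) =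
     (if k = i \<and> l = j then 1 - b - c else if k = i \<and> l = j + 1 then b
      else if k = i + 1 \<and> l = j + 1 then c else 0)"
proof -
  have below: "real i + x - real k \<ge> 1" if "k < i" "0 \<le> x" for x and i k :: nat
    using that by (simp add: nat_less_real_le)
  have above: "real k - (real i + x) \<ge> 1" if "k > i + 1" "x \<le> 1" for x and i k :: nat
    using that by (simp add: nat_less_real_le)
  have far: "hat x y = 0" if "\<bar>x\<bar> \<ge> 1 \<or> \<bar>y\<bar> \<ge> 1 \<or> \<bar>x - y\<bar> \<ge> 1" for x y
    using that by (auto simp: hat_def)
  consider "k < i" | "k > i + 1" | "l < j" | "l > j + 1" | "(k = i \<or> k = i + 1) \<and> (l = j \<or> l = j + 1)"
    by linarith
  note cases = this
  show "hat (real i + (b + c) - real k) (real j + c - real l) =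
     (if k = i \<and> l = j then 1 - b - c else if k = i + 1 \<and> l = j then b
      else if k = i + 1 \<and> l = j + 1 then c else 0)"
    using cases
  proof cases
    case 1 then show ?thesis using below[OF 1, of "b + c"] assms by (simp add: far)
  next
    case 2 then show ?thesis using above[OF 2, of "b + c"] assms by (simp add: far)
  next
    case 3 then show ?thesis using below[OF 3, of c] assms by (simp add: far)
  next
    case 4 then show ?thesis using above[OF 4, of c] assms by (simp add: far)
  next
    case 5
    have "hat (b + c) c = 1 - b - c" "hat (b + c - 1) c = b" "hat (b + c - 1) (c - 1) = c" "hat (b + c) (c - 1) = 0"
      using assms by (simp_all add: hat_def)
    with 5 show ?thesis by (elim conjE disjE) (simp_all add: algebra_simps)
  qed
  show "hat (real i + c - real k) (real j + (b + c) - real l) =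
     (if k = i \<and> l = j then 1 - b - c else if k = i \<and> l = j + 1 then b
      else if k = i + 1 \<and> l = j + 1 then c else 0)"
    using cases
  proof cases
    case 1 then show ?thesis using below[OF 1, of c] assms by (simp add: far)
  next
    case 2 then show ?thesis using above[OF 2, of c] assms by (simp add: far)
  next
    case 3 then show ?thesis using below[OF 3, of "b + c"] assms by (simp add: far)
  next
    case 4 then show ?thesis using above[OF 4, of "b + c"] assms by (simp add: far)
  next
    case 5
    have "hat c (b + c) = 1 - b - c" "hat c (b + c - 1) = b" "hat (c - 1) (b + c - 1) = c" "hat (c - 1) (b + c) = 0"
      using assms by (simp_all add: hat_def)
    with 5 show ?thesis by (elim conjE disjE) (simp_all add: algebra_simps)
  qed
qed

text \<open>The additive form matches the sum in \<open>grid_map\<close> term by term, without an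
  appeal to distinct labels.\<close>

definition bary :: "nat \<Rightarrow> nat \<Rightarrow> nat \<Rightarrow> real \<Rightarrow> real \<Rightarrow> real \<Rightarrow> nat \<Rightarrow> real" where
  "bary a b c A B C v = (if v = a then A else 0) + (if v = b then B else 0) + (if v = c then C else 0)"

lemma sum_indicator_pair:
  fixes i j :: nat and A :: real
  assumes "i \<le> m" "j \<le> n"
  shows "(\<Sum>k\<le>m. \<Sum>l\<le>n. if Q k l then (if k = i \<and> l = j then A else 0) else 0) = (if Q i j then A else 0)"
proof -
  have "(\<Sum>l\<le>n. if Q k l then (if k = i \<and> l = j then A else 0) else 0) =
      (if k = i then (if Q i j then A else 0) else 0)" for k
  proof -
    have "(\<Sum>l\<le>n. if Q k l then (if k = i \<and> l = j then A else 0) else 0) =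
      (\<Sum>l\<le>n. if l = j then (if k = i then (if Q i j then A else 0) else 0) else 0)"
      by (intro sum.cong) auto
    then show ?thesis using assms by simp
  qed
  then show ?thesis using assms by simp
qed

text \<open>The ranges of \<open>l\<close> and \<open>m\<close> are closed, so points on cell
  boundaries have several such descriptions. The gluing lemmas below exploit those with
  \<open>m = 1\<close> and \<open>l = 1\<close>.\<close>

lemma grid_map_bary:
  assumes "i < 3" "j < 3" "0 \<le> l" "l \<le> 1" "0 \<le> m" "m \<le> 1" and p: "3 * fst p = real i + l" "3 * snd p = real j + m"
  shows "m \<le> l \<Longrightarrow> grid_map p =
      bary (grid_label i j) (grid_label (i + 1) j) (grid_label (i + 1) (j + 1)) (1 - l) (l - m) m"
    and "l \<le> m \<Longrightarrow> grid_map p =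
      bary (grid_label i j) (grid_label i (j + 1)) (grid_label (i + 1) (j + 1)) (1 - m) (m - l) l"
proof -
  show "grid_map p =
      bary (grid_label i j) (grid_label (i + 1) j) (grid_label (i + 1) (j + 1)) (1 - l) (l - m) m" if "m \<le> l"
  proof
    fix v
    have hat: "hat (3 * fst p - real k) (3 * snd p - real n) =
       (if k = i \<and> n = j then 1 - l else 0) + (if k = i + 1 \<and> n = j then l - m else 0) +
       (if k = i + 1 \<and> n = j + 1 then m else 0)" for k n
      using hat_grid(1)[of "l - m" m i k j n] assms that by auto
    have "grid_map p v = (\<Sum>k\<le>3. \<Sum>n\<le>3.
        (if grid_label k n = v then (if k = i \<and> n = j then 1 - l else 0) else 0) +
        (if grid_label k n = v then (if k = i + 1 \<and> n = j then l - m else 0) else 0) +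
        (if grid_label k n = v then (if k = i + 1 \<and> n = j + 1 then m else 0) else 0))"
      unfolding grid_map_def hat by (intro sum.cong refl) simp
    then show "grid_map p v = bary (grid_label i j) (grid_label (i + 1) j) (grid_label (i + 1) (j + 1)) (1 - l) (l - m) m v"
      unfolding sum.distrib using assms by (subst (asm) (1 2 3) sum_indicator_pair) (auto simp: bary_def)
  qed
  show "grid_map p =
      bary (grid_label i j) (grid_label i (j + 1)) (grid_label (i + 1) (j + 1)) (1 - m) (m - l) l" if "l \<le> m"
  proof
    fix v
    have hat: "hat (3 * fst p - real k) (3 * snd p - real n) =
       (if k = i \<and> n = j then 1 - m else 0) + (if k = i \<and> n = j + 1 then m - l else 0) +
       (if k = i + 1 \<and> n = j + 1 then l else 0)" for k n
      using hat_grid(2)[of "m - l" l i k j n] assms that by auto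
    have "grid_map p v = (\<Sum>k\<le>3. \<Sum>n\<le>3.
        (if grid_label k n = v then (if k = i \<and> n = j then 1 - m else 0) else 0) +
        (if grid_label k n = v then (if k = i \<and> n = j + 1 then m - l else 0) else 0) +
        (if grid_label k n = v then (if k = i + 1 \<and> n = j + 1 then l else 0) else 0))"
      unfolding grid_map_def hat by (intro sum.cong refl) simp
    then show "grid_map p v = bary (grid_label i j) (grid_label i (j + 1)) (grid_label (i + 1) (j + 1)) (1 - m) (m - l) l v"
      unfolding sum.distrib using assms by (subst (asm) (1 2 3) sum_indicator_pair) (auto simp: bary_def)
  qed
qed

lemma less_three_iff: "(i::nat) < 3 \<longleftrightarrow> i = 0 \<or> i = 1 \<or> i = 2"
  by linarith

lemma grid_label_distinct:
  assumes "i < 3" "j < 3"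
  shows "distinct [grid_label i j, grid_label (i + 1) j, grid_label (i + 1) (j + 1)]"
    "distinct [grid_label i j, grid_label i (j + 1), grid_label (i + 1) (j + 1)]"
  using assms unfolding less_three_iff by (elim disjE; simp add: grid_label_def)+

lemma grid_trianglesE:
  assumes "t \<in> grid_triangles"
  obtains i j where "i < 3" "j < 3"
    "t = {grid_label i j, grid_label (i + 1) j, grid_label (i + 1) (j + 1)} \<or>
     t = {grid_label i j, grid_label i (j + 1), grid_label (i + 1) (j + 1)}"
  using assms unfolding grid_triangles_def by blast

lemma triangle_set_grid: "triangle_set grid_triangles"
proof -
  have card3: "card {a, b, c} = 3" if "distinct [a, b, c]" for a b c :: nat
    using that by simp
  have "card t = 3" if "t \<in> grid_triangles" for t
    using that grid_label_distinct[THEN card3] by (elim grid_trianglesE) metis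
  moreover have "finite grid_triangles" "grid_triangles \<noteq> {}"
    unfolding grid_triangles_def by (simp_all add: lessThan_empty_iff)
  ultimately show ?thesis unfolding triangle_set_def by blast
qed

lemma bary_realization:
  assumes "{a, b, c} \<in> F" "distinct [a, b, c]" "0 \<le> A" "0 \<le> B" "0 \<le> C" "A + B + C = 1"
  shows "bary a b c A B C \<in> realization F"
  by (rule realizationI[OF assms(1)]) (use assms in \<open>auto simp: bary_def\<close>)

lemma realization_baryE:
  assumes "x \<in> realization F" "triangle_set F"
  obtains t where "t \<in> F" "\<And>a b c. t = {a, b, c} \<Longrightarrow> distinct [a, b, c] \<Longrightarrow>
    x = bary a b c (x a) (x b) (x c) \<and> 0 \<le> x a \<and> 0 \<le> x b \<and> 0 \<le> x c \<and> x a + x b + x c = 1"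
proof -
  obtain t where t: "t \<in> F" "\<And>v. 0 \<le> x v" "\<And>v. v \<notin> t \<Longrightarrow> x v = 0" "sum x t = 1"
    using assms by (auto simp: realization_def)
  show ?thesis
  proof (rule that[OF \<open>t \<in> F\<close>])
    fix a b c assume "t = {a, b, c}" "distinct [a, b, c]"
    then show "x = bary a b c (x a) (x b) (x c) \<and> 0 \<le> x a \<and> 0 \<le> x b \<and> 0 \<le> x c \<and> x a + x b + x c = 1"
      using t by (auto simp: bary_def fun_eq_iff)
  qed
qed

lemma grid_coordinate:
  fixes s :: real
  assumes "0 \<le> s" "s \<le> 1"
  obtains i l where "i < 3" "0 \<le> l" "l \<le> 1" "3 * s = real i + l"
proof (cases "s = 1")
  case True
  \<comment> \<open>The floor of \<open>3 * s\<close> would be 3 here; the point is assigned to the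
    last cell.\<close>
  then show ?thesis using that[of 2 1] by simp
next
  case False
  show ?thesis
  proof (rule that[of "nat \<lfloor>3 * s\<rfloor>" "3 * s - of_int \<lfloor>3 * s\<rfloor>"])
    have "\<lfloor>3 * s\<rfloor> < 3" using False assms by (simp add: floor_less_iff)
    then show "nat \<lfloor>3 * s\<rfloor> < 3" by linarith
    show "3 * s = real (nat \<lfloor>3 * s\<rfloor>) + (3 * s - of_int \<lfloor>3 * s\<rfloor>)" using assms by simp
  qed linarith+
qed

lemma grid_map_image: "grid_map ` unit_square = realization grid_triangles"
proof (intro subset_antisym subsetI)
  fix x assume "x \<in> grid_map ` unit_square"
  then obtain p where p: "x = grid_map p" "0 \<le> fst p" "fst p \<le> 1" "0 \<le> snd p" "snd p \<le> 1"
    by (auto simp: unit_square_def)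
  obtain i l where i: "i < 3" "0 \<le> l" "l \<le> 1" "3 * fst p = real i + l" using grid_coordinate p by metis
  obtain j m where j: "j < 3" "0 \<le> m" "m \<le> 1" "3 * snd p = real j + m" using grid_coordinate p by metis
  note rep = grid_map_bary[OF i(1) j(1) i(2,3) j(2,3) i(4) j(4)]
  show "x \<in> realization grid_triangles"
  proof (cases "m \<le> l")
    case True
    show ?thesis unfolding p(1) rep(1)[OF True]
      by (rule bary_realization[OF _ grid_label_distinct(1)])
        (use i j True in \<open>force simp: grid_triangles_def\<close>)+
  next
    case False
    then have "l \<le> m" by simp
    show ?thesis unfolding p(1) rep(2)[OF \<open>l \<le> m\<close>]
      by (rule bary_realization[OF _ grid_label_distinct(2)])
        (use i j \<open>l \<le> m\<close> in \<open>force simp: grid_triangles_def\<close>)+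
  qed
next
  fix x assume "x \<in> realization grid_triangles"
  then obtain t where t: "t \<in> grid_triangles" "\<And>a b c. t = {a, b, c} \<Longrightarrow> distinct [a, b, c] \<Longrightarrow>
    x = bary a b c (x a) (x b) (x c) \<and> 0 \<le> x a \<and> 0 \<le> x b \<and> 0 \<le> x c \<and> x a + x b + x c = 1"
    using realization_baryE triangle_set_grid by metis
  obtain i j where ij: "i < 3" "j < 3"
    "t = {grid_label i j, grid_label (i + 1) j, grid_label (i + 1) (j + 1)} \<or>
     t = {grid_label i j, grid_label i (j + 1), grid_label (i + 1) (j + 1)}"
    using grid_trianglesE[OF t(1)] by metis
  have square: "((real i + l) / 3, (real j + m) / 3) \<in> unit_square" if "0 \<le> l" "l \<le> 1" "0 \<le> m" "m \<le> 1" for l m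
  proof -
    have "real i \<le> 2" "real j \<le> 2" using ij by linarith+
    then show ?thesis using that by (simp add: unit_square_def)
  qed
  from ij(3) show "x \<in> grid_map ` unit_square"
  proof
    assume "t = {grid_label i j, grid_label (i + 1) j, grid_label (i + 1) (j + 1)}"
    note x = t(2)[OF this grid_label_distinct(1)[OF ij(1,2)]]
    define B where "B = x (grid_label (i + 1) j)"
    define C where "C = x (grid_label (i + 1) (j + 1))"
    have BC: "0 \<le> B" "0 \<le> C" "B + C \<le> 1" "x (grid_label i j) = 1 - (B + C)"
      using x unfolding B_def C_def by linarith+
    have "x = bary (grid_label i j) (grid_label (i + 1) j) (grid_label (i + 1) (j + 1)) (x (grid_label i j)) B C"
      using x unfolding B_def C_def by blast
    then have "x = bary (grid_label i j) (grid_label (i + 1) j) (grid_label (i + 1) (j + 1)) (1 - (B + C)) B C" unfolding BC(4) .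
    moreover have "grid_map ((real i + (B + C)) / 3, (real j + C) / 3) =
        bary (grid_label i j) (grid_label (i + 1) j) (grid_label (i + 1) (j + 1)) (1 - (B + C)) B C"
      using grid_map_bary(1)[OF ij(1,2), of "B + C" C "((real i + (B + C)) / 3, (real j + C) / 3)"] BC by simp
    ultimately have "grid_map ((real i + (B + C)) / 3, (real j + C) / 3) = x" by simp
    moreover have "((real i + (B + C)) / 3, (real j + C) / 3) \<in> unit_square"
      using BC by (intro square) auto
    ultimately show ?thesis by (metis image_eqI)
  next
    assume "t = {grid_label i j, grid_label i (j + 1), grid_label (i + 1) (j + 1)}"
    note x = t(2)[OF this grid_label_distinct(2)[OF ij(1,2)]]
    define B where "B = x (grid_label i (j + 1))"
    define C where "C = x (grid_label (i + 1) (j + 1))"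
    have BC: "0 \<le> B" "0 \<le> C" "B + C \<le> 1" "x (grid_label i j) = 1 - (B + C)"
      using x unfolding B_def C_def by linarith+
    have "x = bary (grid_label i j) (grid_label i (j + 1)) (grid_label (i + 1) (j + 1)) (x (grid_label i j)) B C"
      using x unfolding B_def C_def by blast
    then have "x = bary (grid_label i j) (grid_label i (j + 1)) (grid_label (i + 1) (j + 1)) (1 - (B + C)) B C" unfolding BC(4) .
    moreover have "grid_map ((real i + C) / 3, (real j + (B + C)) / 3) =
        bary (grid_label i j) (grid_label i (j + 1)) (grid_label (i + 1) (j + 1)) (1 - (B + C)) B C"
      using grid_map_bary(2)[OF ij(1,2), of C "B + C" "((real i + C) / 3, (real j + (B + C)) / 3)"] BC by simp
    ultimately have "grid_map ((real i + C) / 3, (real j + (B + C)) / 3) = x" by simp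
    moreover have "((real i + C) / 3, (real j + (B + C)) / 3) \<in> unit_square"
      using BC by (intro square) auto
    ultimately show ?thesis by (metis image_eqI)
  qed
qed

section \<open>Recovering a point from its image under the grid map\<close>

text \<open>
  Barycentric coordinates on the circle of length 3 with the vertices 0, 1, 2. The columns of the grid
  recover the first coordinate of a point up to the gluing, and then its rows the second one.
\<close>
definition circle_weight :: "nat \<Rightarrow> real \<Rightarrow> real" where
  "circle_weight k u = (if k = 0 then max 0 (1 - u) + max 0 (u - 2) else max 0 (1 - \<bar>u - real k\<bar>))"

lemma circle_weight_inj:
  assumes "0 \<le> u" "u \<le> 3" "0 \<le> w" "w \<le> 3" "\<And>k. k < 3 \<Longrightarrow> circle_weight k u = circle_weight k w"
  shows "u = w \<or> u = 0 \<and> w = 3 \<or> u = 3 \<and> w = 0"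
proof -
  have "circle_weight 0 u = circle_weight 0 w" "circle_weight 1 u = circle_weight 1 w"
    "circle_weight 2 u = circle_weight 2 w"
    by (intro assms(5); simp)+
  then show ?thesis using assms(1-4)
    by (simp add: circle_weight_def max_def abs_if split: if_splits) 
qed

text \<open>Summing over a column forgets the second coordinate. Column 3 carries the labels of
  column 0, which is why \<open>circle_weight 0\<close> has two humps.\<close>

lemma grid_map_column:
  assumes "p \<in> unit_square" "k < 3"
  shows "grid_map p (3 * k) + grid_map p (3 * k + 1) + grid_map p (3 * k + 2) = circle_weight k (3 * fst p)"
proof -
  have p: "0 \<le> fst p" "fst p \<le> 1" "0 \<le> snd p" "snd p \<le> 1" using assms by (auto simp: unit_square_def)
  obtain i l where i: "i < 3" "0 \<le> l" "l \<le> 1" "3 * fst p = real i + l" using grid_coordinate p by metis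
  obtain j m where j: "j < 3" "0 \<le> m" "m \<le> 1" "3 * snd p = real j + m" using grid_coordinate p by metis
  note rep = grid_map_bary[OF i(1) j(1) i(2,3) j(2,3) i(4) j(4)]
  consider "m \<le> l" | "l \<le> m" by linarith
  then show ?thesis
  proof cases
    case 1
    show ?thesis using assms(2) i(1) j(1) i(2,3) unfolding rep(1)[OF 1] i(4) less_three_iff
      by (elim disjE) (simp_all add: bary_def grid_label_def circle_weight_def)
  next
    case 2
    show ?thesis using assms(2) i(1) j(1) i(2,3) unfolding rep(2)[OF 2] i(4) less_three_iff
      by (elim disjE) (simp_all add: bary_def grid_label_def circle_weight_def)
  qed
qed

text \<open>Rows make sense only in a strip between neighbouring columns, because going once around
  reverses them. Hence the strip \<open>i\<close> is fixed, and second coordinates are compared only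
  for points with equal first coordinates.\<close>

lemma grid_map_row:
  assumes "p \<in> unit_square" "k < 3" "i < 3" "0 \<le> l" "l \<le> 1" "3 * fst p = real i + l"
  shows "grid_map p (grid_label i k) + grid_map p (grid_label (i + 1) k) = circle_weight k (3 * snd p)"
proof -
  have p: "0 \<le> snd p" "snd p \<le> 1" using assms by (auto simp: unit_square_def)
  obtain j m where j: "j < 3" "0 \<le> m" "m \<le> 1" "3 * snd p = real j + m" using grid_coordinate p by metis
  note rep = grid_map_bary[OF assms(3) j(1) assms(4,5) j(2,3) assms(6) j(4)]
  consider "m \<le> l" | "l \<le> m" by linarith
  then show ?thesis
  proof cases
    case 1
    show ?thesis using assms(2,3) j unfolding rep(1)[OF 1] j(4) less_three_iff
      by (elim disjE) (simp_all add: bary_def grid_label_def circle_weight_def)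
  next
    case 2
    show ?thesis using assms(2,3) j unfolding rep(2)[OF 2] j(4) less_three_iff
      by (elim disjE) (simp_all add: bary_def grid_label_def circle_weight_def)
  qed
qed

lemma grid_map_horizontal:
  assumes "s \<in> {0..1}"
  shows "grid_map (s, 0) = grid_map (s, 1)"
proof -
  obtain i l where i: "i < 3" "0 \<le> l" "l \<le> 1" "3 * s = real i + l"
    using grid_coordinate[of s] assms by auto
  have "grid_map (s, 0) = bary (grid_label i 0) (grid_label (i + 1) 0) (grid_label (i + 1) 1) (1 - l) l 0"
    using grid_map_bary(1)[of i 0 l 0 "(s, 0)"] i by simp
  moreover have "grid_map (s, 1) = bary (grid_label i 2) (grid_label i 3) (grid_label (i + 1) 3) 0 (1 - l) l"
    using grid_map_bary(2)[of i 2 l 1 "(s, 1)"] i by simp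
  ultimately show ?thesis using i(1) unfolding less_three_iff
    by (elim disjE) (auto simp: bary_def grid_label_def fun_eq_iff)
qed

lemma grid_map_vertical:
  assumes "t \<in> {0..1}"
  shows "grid_map (0, t) = grid_map (1, 1 - t)"
proof -
  obtain j m where j: "j < 3" "0 \<le> m" "m \<le> 1" "3 * t = real j + m"
    using grid_coordinate[of t] assms by auto
  have "grid_map (0, t) = bary (grid_label 0 j) (grid_label 0 (j + 1)) (grid_label 1 (j + 1)) (1 - m) m 0"
    using grid_map_bary(2)[of 0 j 0 m "(0, t)"] j by simp
  moreover have "grid_map (1, 1 - t) =
      bary (grid_label 2 (2 - j)) (grid_label 3 (2 - j)) (grid_label 3 (2 - j + 1)) 0 m (1 - m)"
    using grid_map_bary(1)[of 2 "2 - j" 1 "1 - m" "(1, 1 - t)"] j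
    by (simp add: of_nat_diff)
  ultimately show ?thesis using j(1) unfolding less_three_iff
    by (elim disjE) (auto simp: bary_def grid_label_def fun_eq_iff)
qed

section \<open>The gluing relation as the fibre relation of the grid map\<close>

lemma klein_rel_refl: "(p, p) \<in> klein_rel"
  by (simp add: klein_rel_def)

lemma klein_rel_sym: "(p, q) \<in> klein_rel \<Longrightarrow> (q, p) \<in> klein_rel"
  unfolding klein_rel_def by (metis converse_Un converse_converse converse_iff rtrancl_converse sup_commute)

lemma klein_rel_trans: "(p, q) \<in> klein_rel \<Longrightarrow> (q, r) \<in> klein_rel \<Longrightarrow> (p, r) \<in> klein_rel"
  unfolding klein_rel_def by (rule rtrancl_trans)

lemma klein_gluing_rel: "(p, q) \<in> klein_gluing \<Longrightarrow> (p, q) \<in> klein_rel"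
  unfolding klein_rel_def by auto

lemma klein_rel_image_eq: "klein_rel `` {p} = klein_rel `` {q} \<longleftrightarrow> (p, q) \<in> klein_rel"
  using klein_rel_refl klein_rel_sym klein_rel_trans by blast

lemma grid_map_klein_rel:
  assumes "(p, q) \<in> klein_rel"
  shows "grid_map p = grid_map q"
  using assms unfolding klein_rel_def
proof (induction rule: rtrancl_induct)
  case (step q r)
  then show ?case using grid_map_horizontal grid_map_vertical by (auto simp: klein_gluing_def)
qed simp

text \<open>Both points lie in one strip, where the rows determine the second coordinate up to the
  identification of 0 and 1; that ambiguity is the gluing of the horizontal sides.\<close>

lemma grid_map_fibre_aligned:
  assumes p: "p \<in> unit_square" and q: "q \<in> unit_square" and "fst p = fst q" "grid_map p = grid_map q"
  shows "(p, q) \<in> klein_rel"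
proof -
  have *: "0 \<le> fst p" "fst p \<le> 1" "0 \<le> snd p" "snd p \<le> 1" "0 \<le> snd q" "snd q \<le> 1"
    using p q by (auto simp: unit_square_def)
  obtain i l where i: "i < 3" "0 \<le> l" "l \<le> 1" "3 * fst p = real i + l" using grid_coordinate * by metis
  have "circle_weight k (3 * snd p) = circle_weight k (3 * snd q)" if "k < 3" for k
    using grid_map_row[OF p that i] grid_map_row[OF q that i(1-3)] i(4) assms by simp
  then have "3 * snd p = 3 * snd q \<or> 3 * snd p = 0 \<and> 3 * snd q = 3 \<or> 3 * snd p = 3 \<and> 3 * snd q = 0"
    using * by (intro circle_weight_inj) auto
  then consider "snd p = snd q" | "snd p = 0" "snd q = 1" | "snd p = 1" "snd q = 0" by auto
  then show ?thesis
  proof cases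
    case 1
    then have "p = q" using assms by (simp add: prod_eq_iff)
    then show ?thesis using klein_rel_refl by simp
  next
    case 2
    then have "(p, q) \<in> klein_gluing"
      using assms * unfolding klein_gluing_def by (cases p; cases q) auto
    then show ?thesis by (rule klein_gluing_rel)
  next
    case 3
    then have "(q, p) \<in> klein_gluing"
      using assms * unfolding klein_gluing_def by (cases p; cases q) auto
    then show ?thesis by (intro klein_rel_sym[OF klein_gluing_rel])
  qed
qed

lemma grid_map_fibre:
  assumes p: "p \<in> unit_square" and q: "q \<in> unit_square"
  shows "grid_map p = grid_map q \<longleftrightarrow> (p, q) \<in> klein_rel"
proof
  assume eq: "grid_map p = grid_map q"
  \<comment> \<open>The point on the right side is replaced by its glued partner on the left side,
    which has the same image. This leads back to the aligned case.\<close>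
  have opposite: "(p, q) \<in> klein_rel" if "p \<in> unit_square" "q \<in> unit_square" "grid_map p = grid_map q" "fst p = 0" "fst q = 1" for p q
  proof -
    have q: "(1 :: real, snd q) = q" using that by (simp add: prod_eq_iff)
    have t: "1 - snd q \<in> {0..1}" using that(2) by (auto simp: unit_square_def)
    have "((0, 1 - snd q), q) \<in> klein_gluing"
      using t q unfolding klein_gluing_def by force
    then have r: "((0, 1 - snd q), q) \<in> klein_rel" by (rule klein_gluing_rel)
    have "(p, (0, 1 - snd q)) \<in> klein_rel"
      using that t grid_map_klein_rel[OF r] by (intro grid_map_fibre_aligned) (auto simp: unit_square_def)
    then show ?thesis using r klein_rel_trans by blast
  qed
  have "circle_weight k (3 * fst p) = circle_weight k (3 * fst q)" if "k < 3" for k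
    using grid_map_column[OF p that] grid_map_column[OF q that] eq by simp
  then have "3 * fst p = 3 * fst q \<or> 3 * fst p = 0 \<and> 3 * fst q = 3 \<or> 3 * fst p = 3 \<and> 3 * fst q = 0"
    using p q by (intro circle_weight_inj) (auto simp: unit_square_def)
  then consider "fst p = fst q" | "fst p = 0" "fst q = 1" | "fst p = 1" "fst q = 0" by auto
  then show "(p, q) \<in> klein_rel"
  proof cases
    case 1 then show ?thesis using grid_map_fibre_aligned p q eq by blast
  next
    case 2 then show ?thesis using opposite p q eq by blast
  next
    case 3 then show ?thesis using opposite[OF q p] eq klein_rel_sym by metis
  qed
qed (rule grid_map_klein_rel)

lemma continuous_grid_map: "continuous_on S grid_map"
proof (rule continuous_on_coordinatewise_then_product)
  fix v
  have "continuous_on S (\<lambda>p. if P then hat (3 * fst p - a) (3 * snd p - b) else 0)" for P a b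
    unfolding hat_def by (cases P) (auto intro!: continuous_intros)
  then show "continuous_on S (\<lambda>p. grid_map p v)"
    unfolding grid_map_def by (intro continuous_intros)
qed

text \<open>Each map is constant on the fibres of the other and so factors through it; the two
  factors are mutually inverse.\<close>

lemma homeomorphic_quotient_spaces:
  assumes f: "quotient_map X Y f" and g: "quotient_map X Z g"
    and fg: "\<And>x y. x \<in> topspace X \<Longrightarrow> y \<in> topspace X \<Longrightarrow> f x = f y \<longleftrightarrow> g x = g y"
  shows "Y homeomorphic_space Z"
proof -
  obtain h where h: "continuous_map Y Z h" "\<And>x. x \<in> topspace X \<Longrightarrow> h (f x) = g x"
    using quotient_map_lift_exists[OF f quotient_imp_continuous_map[OF g]] fg by metis
  obtain k where k: "continuous_map Z Y k" "\<And>x. x \<in> topspace X \<Longrightarrow> k (g x) = f x"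
    using quotient_map_lift_exists[OF g quotient_imp_continuous_map[OF f]] fg by metis
  have "homeomorphic_maps Y Z h k"
    using h k quotient_imp_surjective_map[OF f] quotient_imp_surjective_map[OF g]
    unfolding homeomorphic_maps_def by (metis imageE)
  then show ?thesis by (rule homeomorphic_maps_imp_homeomorphic_space)
qed

lemma grid_klein_bottle: "top_of_set (realization grid_triangles) homeomorphic_space klein_bottle"
proof (rule homeomorphic_quotient_spaces)
  have "compact unit_square" unfolding unit_square_def by (intro compact_Times compact_Icc)
  \<comment> \<open>A continuous surjection from a compact space onto a Hausdorff space is a
    quotient map.\<close>
  then show "quotient_map (top_of_set unit_square) (top_of_set (realization grid_triangles)) grid_map"
    using grid_map_image continuous_grid_map
    by (intro T1_Spaces.continuous_imp_quotient_map)
      (auto simp: continuous_map_in_subtopology compact_space_subtopology Hausdorff_space_subtopology)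
  show "quotient_map (top_of_set unit_square) klein_bottle (\<lambda>p. klein_rel `` {p})"
    unfolding klein_bottle_def by (rule quotient_map_quotient_topology)
qed (simp add: grid_map_fibre klein_rel_image_eq)

section \<open>Triangle lists and sequences of flips\<close>

type_synonym triple = "nat \<times> nat \<times> nat"

fun tri :: "triple \<Rightarrow> nat set" where
  "tri (x, y, z) = {x, y, z}"

fun third :: "nat \<Rightarrow> nat \<Rightarrow> triple \<Rightarrow> nat option" where
  "third a b (x, y, z) =
     (if x = a \<and> y = b \<or> x = b \<and> y = a then Some z
      else if x = a \<and> z = b \<or> x = b \<and> z = a then Some y
      else if y = a \<and> z = b \<or> y = b \<and> z = a then Some x else None)"

text \<open>The tests are the hypotheses of \<open>flip_homeomorphic\<close>: exactly two triangles
  contain the edge, and \<open>cd\<close> is not yet an edge. \<open>None\<close> marks an illegal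
  flip.\<close>

fun flip :: "nat \<times> nat \<Rightarrow> triple list \<Rightarrow> triple list option" where
  "flip (a, b) T = (case List.map_filter (third a b) T of
     [c, d] \<Rightarrow> if distinct [a, b, c, d] \<and> (\<forall>t\<in>set T. third c d t = None)
       then Some ((a, c, d) # (b, c, d) # filter (\<lambda>t. third a b t = None) T) else None
   | _ \<Rightarrow> None)"

fun flips :: "(nat \<times> nat) list \<Rightarrow> triple list \<Rightarrow> triple list option" where
  "flips [] T = Some T"
| "flips (e # es) T = (case flip e T of None \<Rightarrow> None | Some T' \<Rightarrow> flips es T')"

text \<open>Distinctness concerns the vertex sets: a triangle listed again with permuted vertices
  would falsify the degrees computed from the list.\<close>

definition triangle_list :: "triple list \<Rightarrow> bool" where
  "triangle_list T \<longleftrightarrow> T \<noteq> [] \<and> distinct (map tri T) \<and> (\<forall>t\<in>set T. card (tri t) = 3)"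

lemma card_tri: "card (tri (x, y, z)) = 3 \<longleftrightarrow> x \<noteq> y \<and> x \<noteq> z \<and> y \<noteq> z"
  by (auto simp: card_insert_if)

lemma third_Some:
  assumes "third a b t = Some c"
  shows "tri t = {a, b, c}"
  using assms by (cases t) (auto split: if_splits)

lemma third_None:
  assumes "a \<noteq> b"
  shows "third a b t = None \<longleftrightarrow> \<not> (a \<in> tri t \<and> b \<in> tri t)"
  using assms by (cases t) (auto split: if_splits)

lemma triangle_list_triangle_set:
  assumes "triangle_list T"
  shows "triangle_set (tri ` set T)"
  using assms by (auto simp: triangle_list_def triangle_set_def)

lemma set_map_filter_Some: "c \<in> set (List.map_filter f T) \<longleftrightarrow> (\<exists>t\<in>set T. f t = Some c)"
  by (force simp: List.map_filter_def)

text \<open>The new triangles contain the edge \<open>cd\<close>, which no old triangle does, so no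
  triangle is repeated. No vertex disappears, since \<open>a\<close>, \<open>b\<close>,
  \<open>c\<close>, \<open>d\<close> all occur in the new triangles.\<close>

lemma flip_correct:
  assumes T: "triangle_list T" and flip: "flip e T = Some T'"
  shows "triangle_list T'"
    "\<Union> (tri ` set T') = \<Union> (tri ` set T)"
    "top_of_set (realization (tri ` set T')) homeomorphic_space top_of_set (realization (tri ` set T))"
proof -
  obtain a b where e: "e = (a, b)" by (cases e)
  obtain c d where mf: "List.map_filter (third a b) T = [c, d]"
    using flip unfolding e by (auto split: list.splits)
  have ne: "distinct [a, b, c, d]" and cdN: "\<And>t. t \<in> set T \<Longrightarrow> third c d t = None"
    and T': "T' = (a, c, d) # (b, c, d) # filter (\<lambda>t. third a b t = None) T"
    using flip mf unfolding e by (auto split: if_splits)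
  let ?F = "tri ` set T"
  have mem: "\<exists>t\<in>set T. third a b t = Some q" if "q = c \<or> q = d" for q
    using that set_map_filter_Some[of q "third a b" T] mf by auto
  have abF: "{a, b, c} \<in> ?F" "{a, b, d} \<in> ?F"
    using mem[of c] mem[of d] third_Some by (metis image_eqI)+
  have ab: "t = {a, b, c} \<or> t = {a, b, d}" if t: "t \<in> ?F" "a \<in> t" "b \<in> t" for t
  proof -
    obtain u where u: "u \<in> set T" "t = tri u" using t by auto
    then obtain q where q: "third a b u = Some q" using third_None[of a b u] t ne by auto
    then have "q \<in> {c, d}" using set_map_filter_Some[of q "third a b" T] mf u by auto
    then show ?thesis using third_Some[OF q] u by auto
  qed
  have cd: "d \<notin> t" if "t \<in> ?F" "c \<in> t" for t
    using that cdN third_None[of c d] ne by auto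
  have "tri ` set (filter (\<lambda>t. third a b t = None) T) = ?F - {{a, b, c}, {a, b, d}}"
  proof (intro subset_antisym subsetI)
    fix t assume "t \<in> tri ` set (filter (\<lambda>t. third a b t = None) T)"
    then obtain u where u: "u \<in> set T" "t = tri u" "third a b u = None" by auto
    then have "\<not> (a \<in> t \<and> b \<in> t)" using third_None[of a b u] ne by simp
    then show "t \<in> ?F - {{a, b, c}, {a, b, d}}" using u by auto
  next
    fix t assume t: "t \<in> ?F - {{a, b, c}, {a, b, d}}"
    then obtain u where u: "u \<in> set T" "t = tri u" by auto
    have "\<not> (a \<in> t \<and> b \<in> t)" using ab t by blast
    then have "third a b u = None" using third_None[of a b u] ne u by simp
    then show "t \<in> tri ` set (filter (\<lambda>t. third a b t = None) T)" using u by auto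
  qed
  then have F': "tri ` set T' = ?F - {{a, b, c}, {a, b, d}} \<union> {{a, c, d}, {b, c, d}}"
    unfolding T' by auto
  show "top_of_set (realization (tri ` set T')) homeomorphic_space top_of_set (realization (tri ` set T))"
    unfolding F' by (rule flip_homeomorphic[OF triangle_list_triangle_set[OF T] ne abF ab cd])
  show "\<Union> (tri ` set T') = \<Union> ?F"
  proof (intro subset_antisym subsetI)
    fix v assume "v \<in> \<Union> (tri ` set T')"
    then show "v \<in> \<Union> ?F" unfolding F' using abF by blast
  next
    fix v assume "v \<in> \<Union> ?F"
    then show "v \<in> \<Union> (tri ` set T')" unfolding F' by auto
  qed
  let ?G = "filter (\<lambda>t. third a b t = None) T"
  have new: "{a, c, d} \<notin> ?F" "{b, c, d} \<notin> ?F" using cd by auto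
  then have "{a, c, d} \<notin> set (map tri ?G)" "{b, c, d} \<notin> set (map tri ?G)" by auto
  moreover have "{a, c, d} \<noteq> {b, c, d}" using ne by auto
  moreover have "distinct (map tri ?G)" using T by (simp add: triangle_list_def distinct_map_filter)
  ultimately have "distinct (map tri T')" unfolding T' by simp
  moreover have "\<forall>t\<in>set T'. card (tri t) = 3"
    using T ne unfolding T' triangle_list_def by (simp add: card_tri del: tri.simps)
  ultimately show "triangle_list T'" unfolding triangle_list_def T' by blast
qed

lemma flips_correct:
  assumes "triangle_list T" "flips es T = Some T'"
  shows "triangle_list T' \<and> \<Union> (tri ` set T') = \<Union> (tri ` set T) \<and>
    top_of_set (realization (tri ` set T')) homeomorphic_space top_of_set (realization (tri ` set T))"
  using assms
proof (induction es arbitrary: T)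
  case (Cons e es)
  then obtain S where S: "flip e T = Some S" "flips es S = Some T'" by (auto split: option.splits)
  note flip = flip_correct[OF Cons.prems(1) S(1)]
  note IH = Cons.IH[OF flip(1) S(2)]
  show ?case using IH flip(2) homeomorphic_space_trans[OF _ flip(3)] by auto
qed (auto intro: homeomorphic_space_refl)

definition grid_list :: "triple list" where
  "grid_list = concat (map (\<lambda>(i, j).
     [(grid_label i j, grid_label (i + 1) j, grid_label (i + 1) (j + 1)),
      (grid_label i j, grid_label i (j + 1), grid_label (i + 1) (j + 1))]) (List.product [0..<3] [0..<3]))"

text \<open>
  The head of \<open>grid_list\<close> is the triangle \<open>(0, 3, 4)\<close>; it is starred with the tenth vertex 9.
\<close>
definition base_list :: "triple list" where
  "base_list = [(0, 3, 9), (3, 4, 9), (0, 4, 9)] @ tl grid_list"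

lemma grid_triangles_eq: "grid_triangles = tri ` set grid_list"
  unfolding grid_triangles_def grid_list_def by force

lemma distinct_grid_list: "distinct (map tri grid_list)"
  by code_simp

lemma grid_list_Cons: "grid_list = (0, 3, 4) # tl grid_list"
  by code_simp

lemma triangle_list_base: "triangle_list base_list"
  unfolding triangle_list_def by code_simp

lemma verts_base: "\<Union> (tri ` set base_list) = {..<10}"
proof -
  have "{..<10} = set [0..<10]" by auto
  also have "\<dots> = \<Union> (tri ` set base_list)" by code_simp
  finally show ?thesis by simp
qed

lemma base_klein_bottle: "top_of_set (realization (tri ` set base_list)) homeomorphic_space klein_bottle"
proof -
  \<comment> \<open>An abstract set identity, so that the tail of \<open>grid_list\<close> can stay
    folded in this argument.\<close>
  have insert_diff: "B = H - {x} \<union> N" if "x \<notin> G" "H = insert x G" "B = G \<union> N"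
    for x :: "nat set" and B G H N using that by blast
  have "tri (0, 3, 4) \<notin> tri ` set (tl grid_list)"
    using distinct_grid_list by (subst (asm) grid_list_Cons) simp
  then have new: "{0, 3, 4} \<notin> tri ` set (tl grid_list)" unfolding tri.simps .
  have grid: "grid_triangles = insert {0, 3, 4} (tri ` set (tl grid_list))"
    unfolding grid_triangles_eq by (subst grid_list_Cons) simp
  have mem: "{0, 3, 4} \<in> grid_triangles" unfolding grid by simp
  have base: "tri ` set base_list = tri ` set (tl grid_list) \<union> {{0, 3, 9}, {3, 4, 9}, {0, 4, 9}}"
    unfolding base_list_def set_append image_Un by (subst Un_commute) simp
  have "tri ` set base_list = grid_triangles - {{0, 3, 4}} \<union> {{0, 3, 9}, {3, 4, 9}, {0, 4, 9}}"
    by (rule insert_diff[OF new grid base])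
  moreover have "9 \<notin> \<Union> grid_triangles" unfolding grid_triangles_eq by code_simp
  ultimately have "top_of_set (realization (tri ` set base_list)) homeomorphic_space top_of_set (realization grid_triangles)"
    using star_homeomorphic[OF triangle_set_grid, of 0 3 4 9] mem by simp
  then show ?thesis using grid_klein_bottle homeomorphic_space_trans by blast
qed

section \<open>Integral certificates for a realization\<close>

type_synonym ivec = "int \<times> int \<times> int"

fun idiff :: "ivec \<Rightarrow> ivec \<Rightarrow> ivec" where
  "idiff (x, y, z) (x', y', z') = (x - x', y - y', z - z')"

fun icross :: "ivec \<Rightarrow> ivec \<Rightarrow> ivec" where
  "icross (x, y, z) (x', y', z') = (y * z' - z * y', z * x' - x * z', x * y' - y * x')"

fun idot :: "ivec \<Rightarrow> ivec \<Rightarrow> int" where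
  "idot (x, y, z) (x', y', z') = x * x' + y * y' + z * z'"

definition idet :: "ivec list \<Rightarrow> nat \<Rightarrow> nat \<Rightarrow> nat \<Rightarrow> nat \<Rightarrow> int" where
  "idet P v a b c = idot (icross (idiff (P ! a) (P ! v)) (idiff (P ! b) (P ! v))) (idiff (P ! c) (P ! v))"

text \<open>The edges obtained from all triangles at \<open>v\<close> form the link of
  \<open>v\<close>; the star is the cone over it.\<close>

fun opposite :: "nat \<Rightarrow> triple \<Rightarrow> (nat \<times> nat) option" where
  "opposite v (x, y, z) = (if x = v then Some (y, z) else if y = v then Some (x, z)
     else if z = v then Some (x, y) else None)"

text \<open>
  For vectors \<open>A, B, C, D\<close> let \<open>d1, d2, d3, d4\<close> be the determinants of \<open>ABC\<close>, \<open>ABD\<close>, \<open>CDA\<close>, \<open>CDB\<close>.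
  If \<open>sA + tB = pC + qD\<close>, then \<open>p d1 + q d2 = 0\<close>, \<open>s d3 + t d4 = 0\<close> and \<open>s d2 + p d4 = 0\<close>. So one positive
  product makes the cones over \<open>AB\<close> and \<open>CD\<close> meet in the apex only.
\<close>
fun separated :: "int \<Rightarrow> int \<Rightarrow> int \<Rightarrow> int \<Rightarrow> bool" where
  "separated d1 d2 d3 d4 \<longleftrightarrow> 0 < d1 * d2 \<or> 0 < d3 * d4 \<or> 0 < d2 * d4"

text \<open>
  In the first case the determinant that contains the common neighbour twice is 0, so the other one
  has to be nonzero.
\<close>
fun pair_ok :: "ivec list \<Rightarrow> nat \<Rightarrow> nat \<times> nat \<Rightarrow> nat \<times> nat \<Rightarrow> bool" where
  "pair_ok P v (a, b) (c, d) \<longleftrightarrow>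
     (if a = c \<or> a = d \<or> b = c \<or> b = d then idet P v a b c \<noteq> 0 \<or> idet P v a b d \<noteq> 0
      else separated (idet P v a b c) (idet P v a b d) (idet P v c d a) (idet P v c d b))"

fun nondegenerate :: "ivec list \<Rightarrow> nat \<Rightarrow> nat \<times> nat \<Rightarrow> bool" where
  "nondegenerate P v (a, b) \<longleftrightarrow> icross (idiff (P ! a) (P ! v)) (idiff (P ! b) (P ! v)) \<noteq> (0, 0, 0)"

text \<open>\<open>pair_ok P v\<close> is not an order; \<open>sorted_wrt\<close> merely applies it
  once to each pair of list positions.\<close>

definition star_embedded :: "ivec list \<Rightarrow> nat \<Rightarrow> (nat \<times> nat) list \<Rightarrow> bool" where
  "star_embedded P v L \<longleftrightarrow> list_all (nondegenerate P v) L \<and> sorted_wrt (pair_ok P v) L"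

text \<open>
  \<open>True\<close> selects the reflection in the plane \<open>x = 0\<close>, \<open>False\<close> the half-turn about the \<open>z\<close>-axis.
\<close>
fun mirror_or_turn :: "bool \<Rightarrow> ivec \<Rightarrow> ivec" where
  "mirror_or_turn r (x, y, z) = (- x, if r then y else - y, z)"

definition immersed :: "ivec list \<Rightarrow> triple list \<Rightarrow> bool" where
  "immersed P T \<longleftrightarrow> (\<forall>v\<in>set [0..<10]. star_embedded P v (List.map_filter (opposite v) T))"

text \<open>The involution property makes \<open>al\<close> bijective, and \<open>third\<close>
  recognizes the image triangle in any order of its vertices. Agreement with the isometry at the
  vertices is enough, as both sides extend linearly.\<close>

definition symmetric :: "bool \<Rightarrow> nat list \<Rightarrow> ivec list \<Rightarrow> triple list \<Rightarrow> bool" where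
  "symmetric r al P T \<longleftrightarrow>
     (\<forall>v\<in>set [0..<10]. al ! v < 10 \<and> al ! (al ! v) = v \<and> P ! (al ! v) = mirror_or_turn r (P ! v)) \<and>
     (\<exists>v\<in>set [0..<10]. al ! v \<noteq> v) \<and>
     (\<forall>(x, y, z)\<in>set T. \<exists>t\<in>set T. third (al ! x) (al ! y) t = Some (al ! z))"

text \<open>
  Edges to be flipped one after the other in \<open>base_list\<close>, the involution of the vertices, and the
  coordinates of the vertices.
\<close>
type_synonym surface = "(nat \<times> nat) list \<times> nat list \<times> ivec list"

fun valid :: "bool \<Rightarrow> surface \<Rightarrow> bool" where
  "valid r (es, al, P) = (case flips es base_list of None \<Rightarrow> False
     | Some T \<Rightarrow> immersed P T \<and> symmetric r al P T)"

section \<open>Executable form of the isomorphism invariant\<close>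

fun incident :: "nat \<Rightarrow> triple \<Rightarrow> bool" where
  "incident v (x, y, z) \<longleftrightarrow> v = x \<or> v = y \<or> v = z"

fun degree_list :: "nat \<Rightarrow> triple list \<Rightarrow> int" where
  "degree_list v [] = 0"
| "degree_list v (t # T) = (if incident v t then 1 + degree_list v T else degree_list v T)"

fun weight_list :: "triple list \<Rightarrow> triple \<Rightarrow> int" where
  "weight_list T (x, y, z) = degree_list x T * degree_list y T * degree_list z T"

text \<open>A table of the weights, so that the double sum does not count degrees again for every
  pair.\<close>

fun weigh :: "triple list \<Rightarrow> triple list \<Rightarrow> (triple \<times> int) list" where
  "weigh T [] = []"
| "weigh T (t # S) = (t, weight_list T t) # weigh T S"

text \<open>For distinct \<open>x\<close>, \<open>y\<close>, \<open>z\<close> this says that exactly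
  two of them lie in \<open>t\<close>; a triangle is not adjacent to itself.\<close>

fun adjacent :: "triple \<Rightarrow> triple \<Rightarrow> bool" where
  "adjacent (x, y, z) t \<longleftrightarrow>
     (if incident x t then incident y t \<noteq> incident z t else incident y t \<and> incident z t)"

fun neighbour_weight :: "triple \<Rightarrow> (triple \<times> int) list \<Rightarrow> int" where
  "neighbour_weight t [] = 0"
| "neighbour_weight t ((s, b) # W) =
     (if adjacent t s then b + neighbour_weight t W else neighbour_weight t W)"

fun pair_weight :: "(triple \<times> int) list \<Rightarrow> (triple \<times> int) list \<Rightarrow> int" where
  "pair_weight [] W = 0"
| "pair_weight ((t, a) # V) W = a * neighbour_weight t W + pair_weight V W"

text \<open>
  A separate function: rewriting normalizes its argument before it is duplicated.
\<close>
fun square_weight :: "(triple \<times> int) list \<Rightarrow> int" where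
  "square_weight W = pair_weight W W"

fun dual_weight_list :: "triple list \<Rightarrow> int" where
  "dual_weight_list T = square_weight (weigh T T)"

fun triangles_of :: "surface \<Rightarrow> triple list" where
  "triangles_of (es, al, P) = (case flips es base_list of None \<Rightarrow> [] | Some T \<Rightarrow> T)"

section \<open>An isomorphism invariant\<close>

definition degree :: "nat set set \<Rightarrow> nat \<Rightarrow> int" where
  "degree F v = int (card {t \<in> F. v \<in> t})"

definition degree_product :: "nat set set \<Rightarrow> nat set \<Rightarrow> int" where
  "degree_product F t = (\<Prod>v\<in>t. degree F v)"

text \<open>The quadratic form of the adjacency matrix of the dual graph, evaluated at the vector of
  degree products; each dual edge contributes twice.\<close>

definition dual_weight :: "nat set set \<Rightarrow> int" where
  "dual_weight F = (\<Sum>t\<in>F. \<Sum>s\<in>F. if card (t \<inter> s) = 2 then degree_product F t * degree_product F s else 0)"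

lemma dual_weight_image:
  assumes f: "inj_on f (\<Union>F)"
  shows "dual_weight ((`) f ` F) = dual_weight F"
proof -
  have inj: "inj_on ((`) f) F"
    by (rule inj_onI) (metis Sup_upper f inj_on_image_eq_iff)
  have degree: "degree ((`) f ` F) (f v) = degree F v" if "v \<in> \<Union>F" for v
  proof -
    have "{t \<in> (`) f ` F. f v \<in> t} = (`) f ` {t \<in> F. v \<in> t}"
      using that f by (auto simp: inj_on_def) blast
    moreover have "inj_on ((`) f) {t \<in> F. v \<in> t}" using inj by (rule inj_on_subset) auto
    ultimately show ?thesis by (simp add: degree_def card_image)
  qed
  have product: "degree_product ((`) f ` F) (f ` t) = degree_product F t" if "t \<in> F" for t
  proof -
    have "inj_on f t" using f that by (meson Sup_upper inj_on_subset)
    then have "degree_product ((`) f ` F) (f ` t) = (\<Prod>v\<in>t. degree ((`) f ` F) (f v))"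
      by (simp add: degree_product_def prod.reindex)
    also have "\<dots> = degree_product F t"
      unfolding degree_product_def using that by (intro prod.cong refl degree) auto
    finally show ?thesis .
  qed
  have meet: "card (f ` t \<inter> f ` s) = card (t \<inter> s)" if "t \<in> F" "s \<in> F" for t s
  proof -
    have "f ` t \<inter> f ` s = f ` (t \<inter> s)"
      using inj_on_image_Int[OF f, of t s] that by (metis Sup_upper)
    moreover have "inj_on f (t \<inter> s)" using f by (rule inj_on_subset) (use that in auto)
    ultimately show ?thesis by (simp add: card_image)
  qed
  show ?thesis
    unfolding dual_weight_def sum.reindex[OF inj] comp_def
    by (intro sum.cong refl) (simp add: product meet)
qed

text \<open>Injectivity on the vertices preserves the sizes of simplices, so the 3-element
  simplices, which are the generating triangles, correspond to each other.\<close>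

lemma simplicial_iso_facets:
  assumes "triangle_set F" "triangle_set G" "simplicial_iso f (generated F) (generated G)"
  shows "inj_on f (\<Union>F)" "(`) f ` F = G"
proof -
  have f: "inj_on f (\<Union>F)" and im: "(`) f ` generated F = generated G"
    using assms(3) by (auto simp: simplicial_iso_def bij_betw_def verts_generated)
  show "inj_on f (\<Union>F)" by (rule f)
  have "card (f ` \<sigma>) = card \<sigma>" if "\<sigma> \<in> generated F" for \<sigma>
    using that by (intro card_image inj_on_subset[OF f]) (auto simp: generated_def)
  then have "{\<sigma> \<in> (`) f ` generated F. card \<sigma> = 3} = (`) f ` {\<sigma> \<in> generated F. card \<sigma> = 3}"
    by auto
  then show "(`) f ` F = G"
    unfolding im facets_generated[OF assms(1)] facets_generated[OF assms(2)] by simp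
qed

lemma dual_weight_iso:
  assumes "triangle_set F" "triangle_set G" "simplicial_iso f (generated F) (generated G)"
  shows "dual_weight F = dual_weight G"
  using dual_weight_image[OF simplicial_iso_facets(1)[OF assms]] simplicial_iso_facets(2)[OF assms] by simp

section \<open>Agreement of the executable and the set-theoretic invariant\<close>

lemma incident_iff: "incident v t \<longleftrightarrow> v \<in> tri t"
  by (cases t) auto

lemma adjacent_iff:
  assumes "card (tri t) = 3"
  shows "adjacent t s \<longleftrightarrow> card (tri t \<inter> tri s) = 2"
proof -
  obtain x y z where t: "t = (x, y, z)" by (cases t)
  have "x \<noteq> y" "x \<noteq> z" "y \<noteq> z" using assms unfolding t card_tri by auto
  then show ?thesis unfolding t by (auto simp: incident_iff Int_insert_left simp del: incident.simps)
qed

lemma degree_list_sum: "degree_list v T = (\<Sum>t\<leftarrow>T. if incident v t then 1 else 0)"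
  by (induction T) auto

lemma weigh_map: "weigh T S = map (\<lambda>t. (t, weight_list T t)) S"
  by (induction S) auto

lemma neighbour_weight_sum: "neighbour_weight t W = (\<Sum>(s, b)\<leftarrow>W. if adjacent t s then b else 0)"
  by (induction t W rule: neighbour_weight.induct) auto

lemma pair_weight_sum: "pair_weight V W = (\<Sum>(t, a)\<leftarrow>V. a * neighbour_weight t W)"
  by (induction V W rule: pair_weight.induct) auto

lemma dual_weight_list:
  assumes T: "triangle_list T"
  shows "dual_weight_list T = dual_weight (tri ` set T)"
proof -
  have dist: "distinct T" and inj: "inj_on tri (set T)" and card3: "\<And>t. t \<in> set T \<Longrightarrow> card (tri t) = 3"
    using T by (auto simp: triangle_list_def distinct_map)
  have degree: "degree_list v T = degree (tri ` set T) v" for v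
  proof -
    have "{t \<in> tri ` set T. v \<in> t} = tri ` {t \<in> set T. v \<in> tri t}" by auto
    moreover have "inj_on tri {t \<in> set T. v \<in> tri t}" using inj by (rule inj_on_subset) auto
    ultimately have "degree (tri ` set T) v = int (card {t \<in> set T. v \<in> tri t})"
      by (simp add: degree_def card_image)
    also have "\<dots> = (\<Sum>t\<in>set T. if v \<in> tri t then 1 else 0)"
      by (simp add: sum.If_cases Int_def)
    also have "\<dots> = degree_list v T"
      unfolding degree_list_sum incident_iff using dist by (simp add: sum_list_distinct_conv_sum_set)
    finally show ?thesis by simp
  qed
  have weight: "weight_list T t = degree_product (tri ` set T) (tri t)" if "t \<in> set T" for t
  proof -
    obtain x y z where t: "t = (x, y, z)" by (cases t)
    have "x \<noteq> y \<and> x \<noteq> z \<and> y \<noteq> z" using card3[OF that] unfolding t card_tri by auto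
    then show ?thesis unfolding t by (simp add: degree_product_def degree)
  qed
  have "dual_weight_list T = (\<Sum>t\<in>set T. weight_list T t * (\<Sum>s\<in>set T. if adjacent t s then weight_list T s else 0))"
    unfolding dual_weight_list.simps square_weight.simps pair_weight_sum neighbour_weight_sum weigh_map map_map comp_def
    using dist by (simp add: sum_list_distinct_conv_sum_set)
  also have "\<dots> = dual_weight (tri ` set T)"
    unfolding dual_weight_def sum.reindex[OF inj] comp_def sum_distrib_left
    by (intro sum.cong refl) (simp add: weight adjacent_iff card3)
  finally show ?thesis .
qed

section \<open>Immersed stars\<close>

definition rdet :: "real \<times> real \<times> real \<Rightarrow> real \<times> real \<times> real \<Rightarrow> real \<times> real \<times> real \<Rightarrow> real" where
  "rdet A B C = (case (A, B, C) of ((a1, a2, a3), (b1, b2, b3), (c1, c2, c3)) \<Rightarrow>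
     (a2 * b3 - a3 * b2) * c1 + (a3 * b1 - a1 * b3) * c2 + (a1 * b2 - a2 * b1) * c3)"

text \<open>Cramer's rule: the vector equation is inserted into the determinant with two of the four
  vectors held fixed, namely \<open>AB\<close>, \<open>CD\<close>, \<open>BD\<close>,
  \<open>AD\<close> and \<open>BC\<close> in this order.\<close>

lemma cone_relations:
  fixes s t p q a1 a2 a3 b1 b2 b3 c1 c2 c3 d1 d2 d3 :: real
  assumes e: "s * a1 + t * b1 = p * c1 + q * d1" "s * a2 + t * b2 = p * c2 + q * d2"
      "s * a3 + t * b3 = p * c3 + q * d3"
  shows "p * rdet (a1, a2, a3) (b1, b2, b3) (c1, c2, c3) + q * rdet (a1, a2, a3) (b1, b2, b3) (d1, d2, d3) = 0"
    and "s * rdet (c1, c2, c3) (d1, d2, d3) (a1, a2, a3) + t * rdet (c1, c2, c3) (d1, d2, d3) (b1, b2, b3) = 0"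
    and "s * rdet (a1, a2, a3) (b1, b2, b3) (d1, d2, d3) + p * rdet (c1, c2, c3) (d1, d2, d3) (b1, b2, b3) = 0"
    and "t * rdet (a1, a2, a3) (b1, b2, b3) (d1, d2, d3) = p * rdet (c1, c2, c3) (d1, d2, d3) (a1, a2, a3)"
    and "q * rdet (c1, c2, c3) (d1, d2, d3) (b1, b2, b3) = s * rdet (a1, a2, a3) (b1, b2, b3) (c1, c2, c3)"
  unfolding rdet_def prod.case using e by algebra+

lemma nonneg_combination_zero:
  fixes x y d d' :: real
  assumes "0 < d * d'" "0 \<le> x" "0 \<le> y" "x * d + y * d' = 0"
  shows "x = 0" "y = 0"
proof -
  have "x * (d * d) + y * (d * d') = 0" using assms(4) by algebra
  moreover have "0 \<le> x * (d * d)" "0 \<le> y * (d * d')" using assms by simp_all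
  ultimately have "x * (d * d) = 0" "y * (d * d') = 0" by linarith+
  then show "x = 0" "y = 0" using assms(1) by auto
qed

text \<open>The three alternatives are separating planes through the apex: \<open>C\<close> and
  \<open>D\<close> lie strictly on one side of the plane \<open>AB\<close>; \<open>A\<close> and
  \<open>B\<close> on one side of \<open>CD\<close>; \<open>A\<close> and \<open>C\<close> on
  opposite sides of \<open>BD\<close>. Each makes two coefficients vanish, and the relations with
  nonzero determinants remove the other two.\<close>

lemma separated_cones:
  fixes s t p q d1 d2 d3 d4 :: real
  assumes nonneg: "0 \<le> s" "0 \<le> t" "0 \<le> p" "0 \<le> q"
    and r: "p * d1 + q * d2 = 0" "s * d3 + t * d4 = 0" "s * d2 + p * d4 = 0" "t * d2 = p * d3" "q * d4 = s * d1"
    and sep: "0 < d1 * d2 \<or> 0 < d3 * d4 \<or> 0 < d2 * d4"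
  shows "s = 0 \<and> t = 0 \<and> p = 0 \<and> q = 0"
  using sep
proof (elim disjE)
  assume *: "0 < d1 * d2"
  then have "p = 0" "q = 0" using nonneg_combination_zero[OF * nonneg(3,4) r(1)] by auto
  then show ?thesis using r * by auto
next
  assume *: "0 < d3 * d4"
  then have "s = 0" "t = 0" using nonneg_combination_zero[OF * nonneg(1,2) r(2)] by auto
  then show ?thesis using r * by auto
next
  assume *: "0 < d2 * d4"
  then have "s = 0" "p = 0" using nonneg_combination_zero[OF * nonneg(1,3) r(3)] by auto
  then show ?thesis using r * by auto
qed

fun point :: "ivec \<Rightarrow> real^3" where
  "point (x, y, z) = vector [of_int x, of_int y, of_int z]"

fun rvec :: "ivec \<Rightarrow> real \<times> real \<times> real" where
  "rvec (x, y, z) = (of_int x, of_int y, of_int z)"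

definition two_point :: "nat \<Rightarrow> nat \<Rightarrow> real \<Rightarrow> real \<Rightarrow> nat \<Rightarrow> real" where
  "two_point a b s t w = (if w = a then s else 0) + (if w = b then t else 0)"

lemma vec3_eq_iff: "(x :: real^3) = y \<longleftrightarrow> x $ 1 = y $ 1 \<and> x $ 2 = y $ 2 \<and> x $ 3 = y $ 3"
  by (simp add: vec_eq_iff forall_3)

lemma rdet_idet: "real_of_int (idet P v a b c) =
    rdet (rvec (idiff (P ! a) (P ! v))) (rvec (idiff (P ! b) (P ! v))) (rvec (idiff (P ! c) (P ! v)))"
  unfolding idet_def
  by (cases "P ! a"; cases "P ! b"; cases "P ! c"; cases "P ! v") (simp add: rdet_def)

lemma point_combination:
  assumes "s *\<^sub>R (point A - point V) + t *\<^sub>R (point B - point V) = p *\<^sub>R (point C - point V) + q *\<^sub>R (point D - point V)"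
    and "rvec (idiff A V) = (a1, a2, a3)" "rvec (idiff B V) = (b1, b2, b3)"
    and "rvec (idiff C V) = (c1, c2, c3)" "rvec (idiff D V) = (d1, d2, d3)"
  shows "s * a1 + t * b1 = p * c1 + q * d1" "s * a2 + t * b2 = p * c2 + q * d2" "s * a3 + t * b3 = p * c3 + q * d3"
  using assms by (cases A; cases B; cases C; cases D; cases V; auto simp: vec3_eq_iff)+

text \<open>The conclusion compares functions instead of coefficient pairs, because cones with a
  common ray describe a point of this ray by coefficients in different positions. With a common
  neighbour the three different rays are linearly independent, so only the shared coefficient
  survives and it is the same on both sides.\<close>

lemma pair_ok_unique:
  assumes ok: "pair_ok P v (a, b) (c, d)" and ne: "a \<noteq> b" "c \<noteq> d"
    and nonneg: "0 \<le> s" "0 \<le> t" "0 \<le> p" "0 \<le> q"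
    and eq: "s *\<^sub>R (point (P ! a) - point (P ! v)) + t *\<^sub>R (point (P ! b) - point (P ! v)) =
       p *\<^sub>R (point (P ! c) - point (P ! v)) + q *\<^sub>R (point (P ! d) - point (P ! v))"
  shows "two_point a b s t = two_point c d p q"
proof -
  obtain a1 a2 a3 where A: "rvec (idiff (P ! a) (P ! v)) = (a1, a2, a3)" by (cases "rvec (idiff (P ! a) (P ! v))")
  obtain b1 b2 b3 where B: "rvec (idiff (P ! b) (P ! v)) = (b1, b2, b3)" by (cases "rvec (idiff (P ! b) (P ! v))")
  obtain c1 c2 c3 where C: "rvec (idiff (P ! c) (P ! v)) = (c1, c2, c3)" by (cases "rvec (idiff (P ! c) (P ! v))")
  obtain d1 d2 d3 where D: "rvec (idiff (P ! d) (P ! v)) = (d1, d2, d3)" by (cases "rvec (idiff (P ! d) (P ! v))")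
  note e = point_combination[OF eq A B C D]
  note rel = cone_relations[OF e]
  define k1 where "k1 = real_of_int (idet P v a b c)"
  define k2 where "k2 = real_of_int (idet P v a b d)"
  define k3 where "k3 = real_of_int (idet P v c d a)"
  define k4 where "k4 = real_of_int (idet P v c d b)"
  have k: "k1 = rdet (a1, a2, a3) (b1, b2, b3) (c1, c2, c3)" "k2 = rdet (a1, a2, a3) (b1, b2, b3) (d1, d2, d3)"
    "k3 = rdet (c1, c2, c3) (d1, d2, d3) (a1, a2, a3)" "k4 = rdet (c1, c2, c3) (d1, d2, d3) (b1, b2, b3)"
    unfolding k1_def k2_def k3_def k4_def rdet_idet A B C D by simp_all
  note rel = rel[folded k]
  show ?thesis
  proof (cases "a = c \<or> a = d \<or> b = c \<or> b = d")
    case False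
    then have "separated (idet P v a b c) (idet P v a b d) (idet P v c d a) (idet P v c d b)" using ok by simp
    then have "0 < k1 * k2 \<or> 0 < k3 * k4 \<or> 0 < k2 * k4"
      unfolding k1_def k2_def k3_def k4_def separated.simps
      by (simp only: of_int_mult[symmetric] of_int_0_less_iff)
    then have "s = 0 \<and> t = 0 \<and> p = 0 \<and> q = 0" using separated_cones[OF nonneg rel] by simp
    then show ?thesis by (simp add: two_point_def fun_eq_iff)
  next
    case True
    then have nz: "k1 \<noteq> 0 \<or> k2 \<noteq> 0" using ok unfolding k1_def k2_def by simp
    from True consider "a = c" | "a = d" | "b = c" | "b = d" by blast
    then show ?thesis
    proof cases
      case 1
      then have 2: "a1 = c1" "a2 = c2" "a3 = c3" using A C by auto
      have "k1 = 0" "k3 = 0" "k4 = - k2" unfolding k 2 by (simp_all add: rdet_def algebra_simps)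
      then have "q = 0" "t = 0" "s = p" using rel nz by (auto simp: algebra_simps)
      then show ?thesis using 1 by (simp add: two_point_def fun_eq_iff)
    next
      case 2
      then have 3: "a1 = d1" "a2 = d2" "a3 = d3" using A D by auto
      have "k2 = 0" "k3 = 0" "k4 = k1" unfolding k 3 by (simp_all add: rdet_def algebra_simps)
      then have "p = 0" "t = 0" "s = q" using rel nz by (auto simp: algebra_simps)
      then show ?thesis using 2 by (simp add: two_point_def fun_eq_iff)
    next
      case 3
      then have 4: "b1 = c1" "b2 = c2" "b3 = c3" using B C by auto
      have "k1 = 0" "k4 = 0" "k3 = k2" unfolding k 4 by (simp_all add: rdet_def algebra_simps)
      then have "q = 0" "s = 0" "t = p" using rel nz by (auto simp: algebra_simps)
      then show ?thesis using 3 by (simp add: two_point_def fun_eq_iff)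
    next
      case 4
      then have 5: "b1 = d1" "b2 = d2" "b3 = d3" using B D by auto
      have "k2 = 0" "k4 = 0" "k3 = - k1" unfolding k 5 by (simp_all add: rdet_def algebra_simps)
      \<comment> \<open>When \<open>b = d\<close>, none of the five relations links \<open>t\<close>
        to \<open>q\<close>. The missing one is Cramer's rule with \<open>A\<close> and
        \<open>C\<close> held fixed.\<close>
      moreover have "t * k1 = q * k1" unfolding k 5 rdet_def prod.case using e[unfolded 5] by algebra
      ultimately have "p = 0" "s = 0" "t = q" using rel nz by (auto simp: algebra_simps)
      then show ?thesis using 4 by (simp add: two_point_def fun_eq_iff)
    qed
  qed
qed

lemma nondegenerate_unique:
  assumes nd: "nondegenerate P v (a, b)"
    and eq: "s *\<^sub>R (point (P ! a) - point (P ! v)) + t *\<^sub>R (point (P ! b) - point (P ! v)) =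
       p *\<^sub>R (point (P ! a) - point (P ! v)) + q *\<^sub>R (point (P ! b) - point (P ! v))"
  shows "s = p" "t = q"
proof -
  obtain a1 a2 a3 where A: "idiff (P ! a) (P ! v) = (a1, a2, a3)" by (cases "idiff (P ! a) (P ! v)")
  obtain b1 b2 b3 where B: "idiff (P ! b) (P ! v) = (b1, b2, b3)" by (cases "idiff (P ! b) (P ! v)")
  have A': "rvec (idiff (P ! a) (P ! v)) = (of_int a1, of_int a2, of_int a3)"
    and B': "rvec (idiff (P ! b) (P ! v)) = (of_int b1, of_int b2, of_int b3)" by (simp_all add: A B)
  note e = point_combination[OF eq A' B' A' B']
  define n1 n2 n3 where n: "n1 = a2 * b3 - a3 * b2" "n2 = a3 * b1 - a1 * b3" "n3 = a1 * b2 - a2 * b1"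
  have "n1 \<noteq> 0 \<or> n2 \<noteq> 0 \<or> n3 \<noteq> 0" using nd by (auto simp: A B n)
  then have nz: "real_of_int n1 \<noteq> 0 \<or> real_of_int n2 \<noteq> 0 \<or> real_of_int n3 \<noteq> 0" by simp
  have r: "real_of_int n1 = of_int a2 * of_int b3 - of_int a3 * of_int b2"
    "real_of_int n2 = of_int a3 * of_int b1 - of_int a1 * of_int b3"
    "real_of_int n3 = of_int a1 * of_int b2 - of_int a2 * of_int b1"
    by (simp_all add: n)
  have "(s - p) * real_of_int n1 = 0" "(s - p) * real_of_int n2 = 0" "(s - p) * real_of_int n3 = 0"
    "(t - q) * real_of_int n1 = 0" "(t - q) * real_of_int n2 = 0" "(t - q) * real_of_int n3 = 0"
    unfolding r using e by algebra+
  then show "s = p" "t = q" using nz by auto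
qed

section \<open>From pairs of triangles to vertex stars\<close>

lemma sorted_wrt_cases:
  assumes "sorted_wrt R L" "x \<in> set L" "y \<in> set L"
  shows "x = y \<or> R x y \<or> R y x"
proof -
  obtain i where "i < length L" "x = L ! i" using assms(2) by (metis in_set_conv_nth)
  moreover obtain j where "j < length L" "y = L ! j" using assms(3) by (metis in_set_conv_nth)
  ultimately show ?thesis using assms(1) by (metis linorder_neqE_nat sorted_wrt_nth_less)
qed

lemma opposite_Some:
  assumes "v \<in> tri t" "card (tri t) = 3"
  obtains a b where "opposite v t = Some (a, b)" "tri t = {v, a, b}" "v \<noteq> a" "v \<noteq> b" "a \<noteq> b"
proof -
  obtain x y z where t: "t = (x, y, z)" by (cases t)
  have ne: "x \<noteq> y" "x \<noteq> z" "y \<noteq> z" using assms(2) unfolding t card_tri by auto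
  from assms(1) consider "v = x" | "v = y" | "v = z" unfolding t by auto
  then show ?thesis
  proof cases
    case 1
    show ?thesis by (rule that[of y z]) (use 1 ne in \<open>auto simp: t\<close>)
  next
    case 2
    show ?thesis by (rule that[of x z]) (use 2 ne in \<open>auto simp: t\<close>)
  next
    case 3
    show ?thesis by (rule that[of x y]) (use 3 ne in \<open>auto simp: t\<close>)
  qed
qed

lemma simplexwise_linear_triangle:
  assumes "verts K = {..<n}" "{v, a, b} \<subseteq> {..<n}" "distinct [v, a, b]"
    and "\<And>w. w \<notin> {v, a, b} \<Longrightarrow> y w = 0" "y v + y a + y b = 1"
  shows "simplexwise_linear K \<psi> y = \<psi> v + (y a *\<^sub>R (\<psi> a - \<psi> v) + y b *\<^sub>R (\<psi> b - \<psi> v))"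
proof -
  have "simplexwise_linear K \<psi> y = (\<Sum>w\<in>{v, a, b}. y w *\<^sub>R \<psi> w)"
    unfolding simplexwise_linear_def assms(1) using assms by (intro sum.mono_neutral_right) auto
  also have "\<dots> = y v *\<^sub>R \<psi> v + (y a *\<^sub>R \<psi> a + y b *\<^sub>R \<psi> b)" using assms(3) by simp
  also have "y v = 1 - y a - y b" using assms(5) by simp
  finally show ?thesis by (simp add: algebra_simps)
qed

text \<open>A positive coordinate at \<open>v\<close> forces the triangle of the point to contain
  \<open>v\<close>. Eliminating that coordinate through the sum 1 places the image in the cone with
  apex \<open>\<psi> v\<close> over a link edge.\<close>

lemma star_coordinates:
  assumes T: "triangle_list T" "\<Union> (tri ` set T) = {..<10}" and y: "y \<in> realization (tri ` set T)" "0 < y v"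
  obtains a b where "(a, b) \<in> set (List.map_filter (opposite v) T)" "a \<noteq> b" "v \<noteq> a" "v \<noteq> b" "0 \<le> y a" "0 \<le> y b"
    "y = (two_point a b (y a) (y b))(v := 1 - y a - y b)"
    "simplexwise_linear (generated (tri ` set T)) \<psi> y = \<psi> v + (y a *\<^sub>R (\<psi> a - \<psi> v) + y b *\<^sub>R (\<psi> b - \<psi> v))"
proof -
  obtain t where t: "t \<in> set T" "\<And>w. 0 \<le> y w" "\<And>w. w \<notin> tri t \<Longrightarrow> y w = 0" "sum y (tri t) = 1"
    using y(1) by (auto simp: realization_def)
  have "v \<in> tri t" using t(3) y(2) by force
  moreover have "card (tri t) = 3" using T(1) t(1) by (auto simp: triangle_list_def)
  ultimately obtain a b where ab: "opposite v t = Some (a, b)" "tri t = {v, a, b}" "v \<noteq> a" "v \<noteq> b" "a \<noteq> b"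
    using opposite_Some by metis
  have sum1: "y v + y a + y b = 1" using t(4) ab by (simp add: add.assoc)
  show ?thesis
  proof (rule that[of a b])
    show "(a, b) \<in> set (List.map_filter (opposite v) T)" using set_map_filter_Some t(1) ab(1) by metis
    show "y = (two_point a b (y a) (y b))(v := 1 - y a - y b)"
      using sum1 ab t(3) by (auto simp: two_point_def fun_eq_iff)
    have "{v, a, b} \<subseteq> {..<10}" using T(2) t(1) ab(2) by auto
    then show "simplexwise_linear (generated (tri ` set T)) \<psi> y =
        \<psi> v + (y a *\<^sub>R (\<psi> a - \<psi> v) + y b *\<^sub>R (\<psi> b - \<psi> v))"
      using ab t(3) sum1 T(2) by (intro simplexwise_linear_triangle[of _ 10]) (auto simp: verts_generated)
  qed (use ab t in auto)
qed

lemma immersed_polyhedral_realization: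
  assumes T: "triangle_list T" "\<Union> (tri ` set T) = {..<10}" and imm: "immersed P T"
  shows "polyhedral_realization (generated (tri ` set T)) (\<lambda>v. point (P ! v))"
  unfolding polyhedral_realization_def
proof
  let ?S = "space_of (generated (tri ` set T))"
  let ?\<phi> = "simplexwise_linear (generated (tri ` set T)) (\<lambda>v. point (P ! v))"
  have S: "?S = realization (tri ` set T)" by (rule space_of_generated[OF triangle_list_triangle_set[OF T(1)]])
  fix x assume "x \<in> ?S"
  then obtain t where t: "t \<in> set T" "\<And>w. 0 \<le> x w" "sum x (tri t) = 1"
    unfolding S by (auto simp: realization_def)
  have "\<exists>v\<in>tri t. x v \<noteq> 0" using t(3) by (metis sum.neutral zero_neq_one)
  then obtain v where v: "v \<in> tri t" "0 < x v" using t(2) by (metis order_le_less)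
  have "v < 10" using v(1) t(1) T(2) by auto
  then have emb: "star_embedded P v (List.map_filter (opposite v) T)" using imm by (auto simp: immersed_def)
  \<comment> \<open>The open star of \<open>v\<close>. Every point lies in one, since some
    coordinate is positive.\<close>
  define U where "U = ?S \<inter> {y. 0 < y v}"
  have "open {y :: nat \<Rightarrow> real. 0 < y v}"
    by (intro open_Collect_less continuous_on_const continuous_on_coordinate)
  then have "openin (top_of_set ?S) U" unfolding U_def by (rule openin_open_Int)
  moreover have "x \<in> U" using \<open>x \<in> ?S\<close> v by (simp add: U_def)
  moreover have "inj_on ?\<phi> U"
  proof (rule inj_onI)
    fix y y' assume "y \<in> U" "y' \<in> U" and eq: "?\<phi> y = ?\<phi> y'"
    then have y: "y \<in> realization (tri ` set T)" "0 < y v" and y': "y' \<in> realization (tri ` set T)" "0 < y' v"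
      by (auto simp: U_def S)
    obtain a b where ab: "(a, b) \<in> set (List.map_filter (opposite v) T)" "a \<noteq> b" "v \<noteq> a" "v \<noteq> b" "0 \<le> y a" "0 \<le> y b"
      "y = (two_point a b (y a) (y b))(v := 1 - y a - y b)"
      "?\<phi> y = point (P ! v) + (y a *\<^sub>R (point (P ! a) - point (P ! v)) + y b *\<^sub>R (point (P ! b) - point (P ! v)))"
      using star_coordinates[OF T y, of "\<lambda>v. point (P ! v)"] by metis
    obtain c d where cd: "(c, d) \<in> set (List.map_filter (opposite v) T)" "c \<noteq> d" "v \<noteq> c" "v \<noteq> d" "0 \<le> y' c" "0 \<le> y' d"
      "y' = (two_point c d (y' c) (y' d))(v := 1 - y' c - y' d)"
      "?\<phi> y' = point (P ! v) + (y' c *\<^sub>R (point (P ! c) - point (P ! v)) + y' d *\<^sub>R (point (P ! d) - point (P ! v)))"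
      using star_coordinates[OF T y', of "\<lambda>v. point (P ! v)"] by metis
    have comb: "y a *\<^sub>R (point (P ! a) - point (P ! v)) + y b *\<^sub>R (point (P ! b) - point (P ! v)) =
        y' c *\<^sub>R (point (P ! c) - point (P ! v)) + y' d *\<^sub>R (point (P ! d) - point (P ! v))"
      using eq ab(8) cd(8) by simp
    have "(a, b) = (c, d) \<or> pair_ok P v (a, b) (c, d) \<or> pair_ok P v (c, d) (a, b)"
      using sorted_wrt_cases[OF _ ab(1) cd(1)] emb unfolding star_embedded_def by blast
    then have tp: "two_point a b (y a) (y b) = two_point c d (y' c) (y' d)"
    proof (elim disjE)
      assume same: "(a, b) = (c, d)"
      have "nondegenerate P v (a, b)" using emb ab(1) by (auto simp: star_embedded_def list_all_iff)
      then show ?thesis using nondegenerate_unique comb same by (metis Pair_inject)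
    next
      assume "pair_ok P v (a, b) (c, d)"
      then show ?thesis using pair_ok_unique ab cd comb by metis
    next
      assume "pair_ok P v (c, d) (a, b)"
      then show ?thesis using pair_ok_unique ab cd comb by metis
    qed
    \<comment> \<open>The link coordinates are known to agree only as functions. Summing them over
      all four vertices gives equal totals, and the totals determine the coordinates at
      \<open>v\<close>.\<close>
    have total: "y a + y b = y' c + y' d"
    proof -
      have mass: "(\<Sum>w\<in>{a, b, c, d}. two_point i j s t w) = s + t" if "i \<in> {a, b, c, d}" "j \<in> {a, b, c, d}" for i j s t
        using that unfolding two_point_def sum.distrib by (simp add: sum.delta)
      show ?thesis using mass[of a b "y a" "y b"] mass[of c d "y' c" "y' d"] tp by simp
    qed
    show "y = y'" using ab(7) cd(7) tp total by (metis diff_diff_eq)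
  qed
  ultimately show "\<exists>U. openin (top_of_set ?S) U \<and> x \<in> U \<and> inj_on ?\<phi> U" by blast
qed

section \<open>Symmetries and isomorphism classes\<close>

definition symmetry_map :: "bool \<Rightarrow> real^3 \<Rightarrow> real^3" where
  "symmetry_map r x = vector [- (x $ 1), if r then x $ 2 else - (x $ 2), x $ 3]"

lemma symmetry_map_nth [simp]:
  "symmetry_map r x $ 1 = - (x $ 1)" "symmetry_map r x $ 2 = (if r then x $ 2 else - (x $ 2))"
  "symmetry_map r x $ 3 = x $ 3"
  by (simp_all add: symmetry_map_def)

lemma linear_symmetry_map: "linear (symmetry_map r)"
  by (rule linearI) (simp_all add: vec3_eq_iff)

lemma symmetry_map_involution: "symmetry_map r (symmetry_map r x) = x"
  by (simp add: vec3_eq_iff)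

lemma dist_symmetry_map: "dist (symmetry_map r x) (symmetry_map r y) = dist x y"
proof -
  have neg: "dist (- a) (- b) = dist a b" for a b :: real
    by (simp add: dist_real_def)
  show ?thesis by (simp add: dist_vec_def L2_set_def sum_3 neg)
qed

lemma symmetry_map_point: "symmetry_map r (point p) = point (mirror_or_turn r p)"
  by (cases p) (simp add: vec3_eq_iff)

lemma involutory_symmetry_map: "involutory (symmetry_map r)"
proof -
  have "symmetry_map r (vector [1, 0, 0]) $ 1 \<noteq> (vector [1, 0, 0] :: real^3) $ 1" by simp
  then have "symmetry_map r \<noteq> id" by (metis id_apply)
  then show ?thesis by (auto simp: involutory_def symmetry_map_involution fun_eq_iff)
qed

lemma rotation_symmetry_map: "rotation (symmetry_map False)"
proof -
  define A :: "real^3^3" where "A = vector [vector [-1, 0, 0], vector [0, -1, 0], vector [0, 0, 1]]"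
  have "transpose A ** A = mat 1"
    by (simp add: A_def vec_eq_iff forall_3 matrix_matrix_mult_def transpose_def mat_def sum_3)
  moreover have "det A = 1" by (simp add: A_def det_3)
  ultimately have "rotation_matrix A" by (simp add: rotation_matrix_def orthogonal_matrix)
  moreover have "symmetry_map False = (\<lambda>x. 0 + A *v (x - 0))"
    by (simp add: A_def fun_eq_iff vec3_eq_iff matrix_vector_mult_def sum_3)
  ultimately show ?thesis unfolding rotation_def by blast
qed

text \<open>The half-turn reverses a plane of vectors, a reflection only a line: the first two basis
  vectors would both have to be parallel to \<open>u\<close>. The equivalence is what makes the
  count of reflections exact.\<close>

lemma plane_reflection_symmetry_map: "plane_reflection (symmetry_map r) \<longleftrightarrow> r"
proof
  assume "plane_reflection (symmetry_map r)"
  then obtain u :: "real^3" and b where u: "norm u = 1" "symmetry_map r = (\<lambda>x. x - (2 * (u \<bullet> x - b)) *\<^sub>R u)"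
    by (auto simp: plane_reflection_def)
  have eq: "symmetry_map r x = x - (2 * (u \<bullet> x - b)) *\<^sub>R u" for x by (simp add: u(2))
  have "u \<noteq> 0" using u(1) by auto
  \<comment> \<open>The origin is fixed, so a mirror plane would pass through it.\<close>
  have "symmetry_map r 0 = 0" using linear_symmetry_map by (rule linear_0)
  then have "b = 0" using eq[of 0] \<open>u \<noteq> 0\<close> by simp
  show r
  proof (rule ccontr)
    assume "\<not> r"
    have "u $ 1 * u $ 1 = 1" "u $ 1 * u $ 2 = 0"
      using arg_cong[OF eq[of "vector [1, 0, 0]"], of "\<lambda>x. x $ 1"]
        arg_cong[OF eq[of "vector [1, 0, 0]"], of "\<lambda>x. x $ 2"] \<open>b = 0\<close> \<open>\<not> r\<close>
      by (simp_all add: inner_vec_def sum_3)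
    moreover have "u $ 2 * u $ 2 = 1"
      using arg_cong[OF eq[of "vector [0, 1, 0]"], of "\<lambda>x. x $ 2"] \<open>b = 0\<close> \<open>\<not> r\<close>
      by (simp add: inner_vec_def sum_3)
    ultimately show False by auto
  qed
next
  assume r
  define u :: "real^3" where "u = vector [1, 0, 0]"
  have "norm u = 1" by (simp add: u_def norm_vec_def L2_set_def sum_3)
  moreover have "symmetry_map r = (\<lambda>x. x - (2 * (u \<bullet> x - 0)) *\<^sub>R u)"
    using \<open>r\<close> by (simp add: fun_eq_iff vec3_eq_iff u_def inner_vec_def sum_3)
  ultimately show "plane_reflection (symmetry_map r)" unfolding plane_reflection_def by blast
qed

lemma induced_map_realization:
  assumes F: "triangle_set F" and inj: "inj_on \<alpha> (\<Union>F)" and \<alpha>: "\<And>t. t \<in> F \<Longrightarrow> \<alpha> ` t \<in> F"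
    and x: "x \<in> realization F"
  shows "induced_map (generated F) \<alpha> x \<in> realization F"
proof -
  let ?y = "induced_map (generated F) \<alpha> x"
  obtain t where t: "t \<in> F" "\<And>v. 0 \<le> x v" "\<And>v. v \<notin> t \<Longrightarrow> x v = 0" "sum x t = 1"
    using x by (auto simp: realization_def)
  have y: "?y (\<alpha> v) = x v" if "v \<in> \<Union>F" for v
  proof -
    have "{w \<in> verts (generated F). \<alpha> w = \<alpha> v} = {v}"
      unfolding verts_generated using that inj by (auto dest: inj_onD)
    then show ?thesis by (simp add: induced_map_def)
  qed
  show ?thesis
  proof (rule realizationI[OF \<alpha>[OF t(1)]])
    show "0 \<le> ?y v" for v unfolding induced_map_def using t(2) by (simp add: sum_nonneg)
    show "?y v = 0" if "v \<notin> \<alpha> ` t" for v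
      unfolding induced_map_def using t(3) that by (intro sum.neutral) auto
    have "inj_on \<alpha> t" using inj t(1) by (meson Sup_upper inj_on_subset)
    then have "sum ?y (\<alpha> ` t) = (\<Sum>v\<in>t. ?y (\<alpha> v))" by (simp add: sum.reindex)
    also have "\<dots> = sum x t" using t(1) by (intro sum.cong refl y) auto
    finally show "sum ?y (\<alpha> ` t) = 1" using t(4) by simp
  qed
qed

text \<open>By linearity both sides combine the points \<open>\<psi> (\<alpha> v)\<close>; grouping
  the sum by the value of \<open>\<alpha>\<close> yields the fibre sums of
  \<open>induced_map\<close>.\<close>

lemma simplexwise_linear_induced:
  assumes "finite (verts K)" "\<alpha> ` verts K \<subseteq> verts K" "linear g" "\<And>v. v \<in> verts K \<Longrightarrow> g (\<psi> v) = \<psi> (\<alpha> v)"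
  shows "g (simplexwise_linear K \<psi> x) = simplexwise_linear K \<psi> (induced_map K \<alpha> x)"
proof -
  have "g (simplexwise_linear K \<psi> x) = (\<Sum>v\<in>verts K. x v *\<^sub>R \<psi> (\<alpha> v))"
    unfolding simplexwise_linear_def linear_sum[OF assms(3)]
    by (intro sum.cong refl) (simp add: linear_scale[OF assms(3)] assms(4))
  also have "\<dots> = (\<Sum>w\<in>verts K. \<Sum>v\<in>{v \<in> verts K. \<alpha> v = w}. x v *\<^sub>R \<psi> (\<alpha> v))"
    by (rule sum.group[symmetric]) (use assms in auto)
  also have "\<dots> = simplexwise_linear K \<psi> (induced_map K \<alpha> x)"
    unfolding simplexwise_linear_def induced_map_def scaleR_sum_left
    by (intro sum.cong refl) auto
  finally show ?thesis .
qed

lemma symmetric_geometric_symmetry: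
  assumes T: "triangle_list T" "\<Union> (tri ` set T) = {..<10}" and sym: "symmetric r al P T"
  shows "geometric_symmetry (generated (tri ` set T)) (\<lambda>v. point (P ! v)) (symmetry_map r)"
proof -
  let ?F = "tri ` set T" and ?\<psi> = "\<lambda>v. point (P ! v)"
  let ?K = "generated ?F"
  define \<alpha> where "\<alpha> v = al ! v" for v
  have F: "triangle_set ?F" by (rule triangle_list_triangle_set[OF T(1)])
  have verts: "verts ?K = {..<10}" using T(2) by (simp add: verts_generated)
  have \<alpha>: "\<alpha> v < 10" "\<alpha> (\<alpha> v) = v" "P ! \<alpha> v = mirror_or_turn r (P ! v)" if "v < 10" for v
    using sym that by (auto simp: symmetric_def \<alpha>_def)
  obtain v0 where v0: "v0 < 10" "\<alpha> v0 \<noteq> v0" using sym by (auto simp: symmetric_def \<alpha>_def)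
  have bij: "bij_betw \<alpha> {..<10} {..<10}"
    by (rule bij_betwI[where g = \<alpha>]) (use \<alpha> in auto)
  have \<alpha>F: "\<alpha> ` t \<in> ?F" if t: "t \<in> ?F" for t
  proof -
    obtain u where u: "u \<in> set T" "t = tri u" using t by auto
    obtain x y z where xyz: "u = (x, y, z)" by (cases u)
    obtain s where "s \<in> set T" "third (\<alpha> x) (\<alpha> y) s = Some (\<alpha> z)"
      using sym u(1) unfolding symmetric_def \<alpha>_def xyz by blast
    then have "tri s = {\<alpha> x, \<alpha> y, \<alpha> z}" by (intro third_Some)
    also have "\<dots> = \<alpha> ` t" using u xyz by auto
    finally show ?thesis using \<open>s \<in> set T\<close> by auto
  qed
  have inv_image: "\<alpha> ` \<alpha> ` \<sigma> = \<sigma>" if "\<sigma> \<subseteq> {..<10}" for \<sigma>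
    using that \<alpha>(2) by (force simp: image_iff)
  have \<alpha>K: "\<alpha> ` \<sigma> \<in> ?K" if \<sigma>: "\<sigma> \<in> ?K" for \<sigma>
  proof -
    obtain t where t: "t \<in> ?F" "\<sigma> \<subseteq> t" "\<sigma> \<noteq> {}" using \<sigma> unfolding generated_def by blast
    have "\<alpha> ` \<sigma> \<noteq> {}" "\<alpha> ` \<sigma> \<subseteq> \<alpha> ` t" using t by auto
    then show ?thesis unfolding generated_def mem_Collect_eq by (intro conjI bexI[OF _ \<alpha>F[OF t(1)]])
  qed
  have "(`) \<alpha> ` ?K = ?K"
  proof (intro subset_antisym subsetI)
    fix \<sigma> assume "\<sigma> \<in> ?K"
    then have "\<alpha> ` \<alpha> ` \<sigma> = \<sigma>" using verts by (intro inv_image) (auto simp: verts_def)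
    then show "\<sigma> \<in> (`) \<alpha> ` ?K" using \<alpha>K[OF \<open>\<sigma> \<in> ?K\<close>] by (metis imageI)
  qed (use \<alpha>K in auto)
  then have "automorphism ?K \<alpha>"
    using bij by (simp add: automorphism_def simplicial_iso_def verts)
  have equiv: "symmetry_map r (simplexwise_linear ?K ?\<psi> x) = simplexwise_linear ?K ?\<psi> (induced_map ?K \<alpha> x)" for x
    by (rule simplexwise_linear_induced[OF _ _ linear_symmetry_map])
      (use \<alpha> in \<open>auto simp: verts symmetry_map_point\<close>)
  have S: "space_of ?K = realization ?F" by (rule space_of_generated[OF F])
  have "inj_on \<alpha> (\<Union>?F)" using bij T(2) by (simp add: bij_betw_def)
  then have stable: "symmetry_map r p \<in> simplexwise_linear ?K ?\<psi> ` space_of ?K"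
    if "p \<in> simplexwise_linear ?K ?\<psi> ` space_of ?K" for p
    using that induced_map_realization[OF F _ \<alpha>F] equiv unfolding S by blast
  \<comment> \<open>One inclusion suffices because the map is its own inverse.\<close>
  have "symmetry_map r ` simplexwise_linear ?K ?\<psi> ` space_of ?K = simplexwise_linear ?K ?\<psi> ` space_of ?K"
  proof (intro subset_antisym subsetI)
    fix p assume "p \<in> simplexwise_linear ?K ?\<psi> ` space_of ?K"
    from stable[OF this] show "p \<in> symmetry_map r ` simplexwise_linear ?K ?\<psi> ` space_of ?K"
      by (metis imageI symmetry_map_involution)
  qed (use stable in auto)
  then show ?thesis
    unfolding geometric_symmetry_def
    using dist_symmetry_map \<open>automorphism ?K \<alpha>\<close> v0 verts equiv by blast
qed

section \<open>Isomorphism classes of the certified surfaces\<close>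

definition complex_of :: "surface \<Rightarrow> nat set set" where
  "complex_of d = generated (tri ` set (triangles_of d))"

definition class_of :: "surface \<Rightarrow> nat set set set" where
  "class_of d = {(K, L). K \<in> triangulations klein_bottle 10 \<and> L \<in> triangulations klein_bottle 10 \<and>
     (\<exists>f. simplicial_iso f K L)} `` {complex_of d}"

lemma valid_surface:
  assumes "valid r d"
  obtains es al P T where "d = (es, al, P)" "triangles_of d = T" "immersed P T" "symmetric r al P T"
    "triangle_list T" "\<Union> (tri ` set T) = {..<10}"
    "top_of_set (realization (tri ` set T)) homeomorphic_space klein_bottle"
proof -
  obtain es al P where d: "d = (es, al, P)" by (cases d)
  then obtain T where T: "flips es base_list = Some T" "immersed P T" "symmetric r al P T"
    using assms by (auto split: option.splits)
  have "triangles_of d = T" using T(1) by (simp add: d)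
  moreover have "triangle_list T \<and> \<Union> (tri ` set T) = {..<10} \<and>
      top_of_set (realization (tri ` set T)) homeomorphic_space top_of_set (realization (tri ` set base_list))"
    using flips_correct[OF triangle_list_base T(1)] unfolding verts_base .
  moreover from this have "top_of_set (realization (tri ` set T)) homeomorphic_space klein_bottle"
    using homeomorphic_space_trans base_klein_bottle by metis
  ultimately show ?thesis using that[OF d _ T(2,3)] by metis
qed

lemma valid_triangulation:
  assumes "valid r d"
  shows "complex_of d \<in> triangulations klein_bottle 10"
  using assms
proof (rule valid_surface)
  fix es al P T
  assume "triangles_of d = T" and T: "triangle_list T" "\<Union> (tri ` set T) = {..<10}"
    "top_of_set (realization (tri ` set T)) homeomorphic_space klein_bottle"
  then show ?thesis
    using triangulation_of_generated[OF triangle_list_triangle_set[OF T(1)] T(3)]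
    by (simp add: complex_of_def triangulations_def verts_generated)
qed

lemma simplicial_iso_refl: "simplicial_iso id K K"
  by (simp add: simplicial_iso_def)

lemma valid_class:
  assumes "valid r d"
  shows "class_of d \<in> triangulation_classes klein_bottle 10" "complex_of d \<in> class_of d"
  using valid_triangulation[OF assms] simplicial_iso_refl
  unfolding class_of_def triangulation_classes_def by (blast intro: quotientI)+

lemma valid_realizes:
  assumes "valid r d"
  shows "realizes_symmetry (class_of d) (symmetry_map r)"
  using assms
proof (rule valid_surface)
  fix es al P T
  assume "triangles_of d = T" "immersed P T" "symmetric r al P T"
    "triangle_list T" "\<Union> (tri ` set T) = {..<10}"
  then show ?thesis
    unfolding realizes_symmetry_def
    using immersed_polyhedral_realization symmetric_geometric_symmetry valid_class(2)[OF assms]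
    by (metis complex_of_def)
qed

text \<open>By reflexivity the complex of \<open>d'\<close> lies in its own class, which is that of
  \<open>d\<close>; this membership is an isomorphism, and it preserves the invariant.\<close>

lemma class_of_eq:
  assumes "valid r d" "valid r' d'" "class_of d = class_of d'"
  shows "dual_weight_list (triangles_of d) = dual_weight_list (triangles_of d')"
proof -
  have T: "triangle_list (triangles_of d)" "triangle_list (triangles_of d')"
    using assms(1,2) by (auto elim!: valid_surface simp del: valid.simps triangles_of.simps dual_weight_list.simps)
  have "complex_of d' \<in> class_of d" using valid_class(2)[OF assms(2)] assms(3) by simp
  then obtain f where "simplicial_iso f (complex_of d) (complex_of d')" by (auto simp: class_of_def)
  then show ?thesis
    unfolding complex_of_def dual_weight_list[OF T(1)] dual_weight_list[OF T(2)]
    using dual_weight_iso[OF T[THEN triangle_list_triangle_set]] by simp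
qed

text \<open>Distinct invariants on the joined list do three things: they exclude repeated data, make
  \<open>class_of\<close> injective, and keep the classes of \<open>R\<close> apart from those of
  \<open>Q\<close>. For the rotations a lower bound is enough, 67 of 76 being more than half; for
  the reflections the set has to be determined exactly.\<close>

lemma symmetric_realizations:
  fixes R Q :: "surface list"
  assumes R: "list_all (valid True) R" "length R = 9" and Q: "list_all (valid False) Q" "length Q = 67"
    and dist: "distinct (map (\<lambda>d. dual_weight_list (triangles_of d)) (R @ Q))"
  shows "\<exists>S \<subseteq> triangulation_classes klein_bottle 10. \<exists>g :: nat set set set \<Rightarrow> real^3 \<Rightarrow> real^3.
       card S = 76 \<and>
       (\<forall>c\<in>S. involutory (g c) \<and> realizes_symmetry c (g c)) \<and>
       2 * card {c \<in> S. rotation (g c)} > card S \<and>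
       card {c \<in> S. plane_reflection (g c)} = 9"
proof -
  have valid: "valid True d" if "d \<in> set R" for d using that R(1) by (auto simp: list_all_iff)
  have valid': "valid False d" if "d \<in> set Q" for d using that Q(1) by (auto simp: list_all_iff)
  have ex_valid: "\<exists>r. valid r d" if "d \<in> set (R @ Q)" for d using that valid valid' unfolding set_append by blast
  have inj: "inj_on class_of (set (R @ Q))"
  proof (rule inj_onI)
    fix d d' assume d: "d \<in> set (R @ Q)" "d' \<in> set (R @ Q)" "class_of d = class_of d'"
    then have "dual_weight_list (triangles_of d) = dual_weight_list (triangles_of d')"
      using class_of_eq ex_valid by metis
    then show "d = d'" using dist d(1,2) unfolding distinct_map by (auto dest: inj_onD)
  qed
  have distinct: "distinct (R @ Q)" using dist unfolding distinct_map by (rule conjunct1)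
  have card_class: "card (class_of ` A) = card A" if "A \<subseteq> set (R @ Q)" for A
    using inj_on_subset[OF inj that] by (rule card_image)
  \<comment> \<open>The truth value itself selects the reflection or the half-turn.\<close>
  define g where "g c = symmetry_map (c \<in> class_of ` set R)" for c
  have gR: "g (class_of d) = symmetry_map True" if "d \<in> set R" for d using that by (simp add: g_def)
  have notin: "class_of d \<notin> class_of ` set R" if "d \<in> set Q" for d
  proof
    assume "class_of d \<in> class_of ` set R"
    then obtain d' where d': "d' \<in> set R" "class_of d = class_of d'" by auto
    then have "d = d'" using inj_onD[OF inj] that by auto
    then show False using distinct d'(1) that by auto
  qed
  then have gQ: "g (class_of d) = symmetry_map False" if "d \<in> set Q" for d using that by (simp add: g_def)
  let ?S = "class_of ` set (R @ Q)"
  have "?S \<subseteq> triangulation_classes klein_bottle 10" using valid_class(1) ex_valid by blast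
  moreover have cardS: "card ?S = 76"
    using card_class[of "set (R @ Q)"] distinct_card[OF distinct] R(2) Q(2) by simp
  moreover have "involutory (g c) \<and> realizes_symmetry c (g c)" if c: "c \<in> ?S" for c
  proof -
    obtain d where "c = class_of d" "d \<in> set R \<or> d \<in> set Q" using c unfolding set_append by blast
    then show ?thesis
      using gR gQ valid valid' valid_realizes involutory_symmetry_map by metis
  qed
  moreover have "2 * card {c \<in> ?S. rotation (g c)} > card ?S"
  proof -
    have "class_of ` set Q \<subseteq> {c \<in> ?S. rotation (g c)}" using gQ rotation_symmetry_map by auto
    then have "card (class_of ` set Q) \<le> card {c \<in> ?S. rotation (g c)}" by (intro card_mono) auto
    moreover have "card (class_of ` set Q) = 67"
      using card_class[of "set Q"] distinct distinct_card[of Q] Q(2) by simp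
    ultimately show ?thesis using cardS by simp
  qed
  moreover have "card {c \<in> ?S. plane_reflection (g c)} = 9"
  proof -
    have "{c \<in> ?S. plane_reflection (g c)} = class_of ` set R"
      unfolding g_def plane_reflection_symmetry_map by auto
    then show ?thesis
      using card_class[of "set R"] distinct distinct_card[of R] R(2) by simp
  qed
  ultimately show ?thesis by blast
qed

section \<open>The surfaces\<close>

text \<open>Vertices fixed by the involution lie in the plane \<open>x = 0\<close>. The empty flip
  list stands for \<open>base_list\<close> itself, which already has such a symmetry.\<close>

definition mirror_surfaces :: "surface list" where
  "mirror_surfaces =
   [([],
     [0, 2, 1, 4, 3, 5, 8, 7, 6, 9],
     [(0, 0, 0), (1, - 2, 2), (- 1, - 2, 2), (- 2, - 2, 1), (2, - 2, 1), (0, 2, 2), (- 2, - 1, - 2), (0, - 1, - 1), (2, - 1, - 2), (0, 1, - 2)]),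
    ([(1, 2)],
     [0, 2, 1, 4, 3, 5, 8, 7, 6, 9],
     [(0, 0, - 2), (- 1, 1, 0), (1, 1, 0), (2, 1, 1), (- 2, 1, 1), (0, 2, 1), (2, - 1, 2), (0, 0, 0), (- 2, - 1, 2), (0, - 1, - 2)]),
    ([(6, 8)],
     [0, 2, 1, 4, 3, 5, 8, 7, 6, 9],
     [(0, - 1, 1), (- 1, - 2, - 2), (1, - 2, - 2), (2, 0, - 1), (- 2, 0, - 1), (0, 2, - 1), (2, 2, 1), (0, 0, 0), (- 2, 2, 1), (0, - 1, 2)]),
    ([(0, 3), (0, 4)],
     [0, 2, 1, 4, 3, 5, 8, 7, 6, 9],
     [(0, 1, - 2), (1, - 1, 0), (- 1, - 1, 0), (- 1, 2, 2), (1, 2, 2), (0, 1, 1), (- 2, - 1, 1), (0, - 2, 1), (2, - 1, 1), (0, - 1, - 2)]),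
    ([(0, 3), (0, 4), (1, 2)],
     [0, 2, 1, 4, 3, 5, 8, 7, 6, 9],
     [(0, - 1, - 2), (2, - 2, 0), (- 2, - 2, 0), (- 1, 2, 1), (1, 2, 1), (0, 0, 0), (- 2, 0, 1), (0, - 2, 2), (2, 0, 1), (0, - 2, - 2)]),
    ([(0, 3), (0, 4), (1, 2), (0, 9)],
     [0, 2, 1, 4, 3, 5, 8, 7, 6, 9],
     [(0, 2, 1), (1, 0, - 1), (- 1, 0, - 1), (- 2, - 1, 0), (2, - 1, 0), (0, - 2, - 2), (- 2, - 1, 2), (0, 0, 0), (2, - 1, 2), (0, 2, - 1)]),
    ([(0, 3), (0, 4), (1, 2), (0, 9), (3, 4)],
     [0, 2, 1, 4, 3, 5, 8, 7, 6, 9],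
     [(0, 1, 2), (1, - 1, 2), (- 1, - 1, 2), (- 1, 2, - 2), (1, 2, - 2), (0, 1, 0), (- 2, 0, - 1), (0, - 2, - 1), (2, 0, - 1), (0, 2, 0)]),
    ([(0, 3), (0, 4), (3, 4)],
     [0, 2, 1, 4, 3, 5, 8, 7, 6, 9],
     [(0, 1, 3), (- 2, - 3, - 2), (2, - 3, - 2), (1, 2, 1), (- 1, 2, 1), (0, 0, 0), (3, - 1, - 2), (0, 3, - 3), (- 3, - 1, - 2), (0, - 1, 2)]),
    ([(0, 3), (1, 4), (5, 8), (7, 8), (4, 7)],
     [2, 1, 0, 4, 3, 5, 6, 8, 7, 9],
     [(3, - 3, 2), (0, 0, 0), (- 3, - 3, 2), (- 3, 0, 1), (3, 0, 1), (0, - 1, 3), (0, 3, - 3), (- 1, 2, - 2), (1, 2, - 2), (0, - 2, - 3)])]"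

text \<open>Vertices fixed by the involution lie on the \<open>z\<close>-axis. Along the list the
  coordinate box grows from absolute value at most 2 to at most 29.\<close>

definition turn_surfaces :: "surface list" where
  "turn_surfaces =
   [([(3, 4)],
     [7, 6, 8, 4, 3, 5, 1, 0, 2, 9],
     [(2, 0, 0), (1, - 1, - 2), (- 1, 2, 0), (- 2, - 2, 0), (2, 2, 0), (0, 0, - 1), (- 1, 1, - 2), (- 2, 0, 0), (1, - 2, 0), (0, 0, 1)]),
    ([(0, 3), (0, 2)],
     [9, 2, 1, 8, 6, 7, 4, 5, 3, 0],
     [(- 2, - 1, - 2), (- 1, 1, - 1), (1, - 1, - 1), (1, - 2, 1), (2, - 1, - 1), (- 1, 2, 0), (- 2, 1, - 1), (1, - 2, 0), (- 1, 2, 1), (2, 1, - 2)]),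
    ([(0, 3), (0, 2), (0, 9)],
     [9, 2, 1, 8, 6, 7, 4, 5, 3, 0],
     [(- 1, - 2, 0), (0, - 1, 0), (0, 1, 0), (- 1, 0, 2), (0, 2, - 1), (1, 0, 1), (0, - 2, - 1), (- 1, 0, 1), (1, 0, 2), (1, 2, 0)]),
    ([(0, 3), (0, 2), (1, 4)],
     [2, 9, 0, 8, 7, 6, 5, 4, 3, 1],
     [(1, - 2, 1), (2, - 1, 1), (- 1, 2, 1), (- 2, - 2, 2), (- 1, 1, - 2), (1, - 1, 0), (- 1, 1, 0), (1, - 1, - 2), (2, 2, 2), (- 2, 1, 1)]),
    ([(0, 3), (3, 4), (4, 7)],
     [6, 7, 8, 4, 3, 9, 0, 1, 2, 5],
     [(0, 1, 0), (0, - 2, - 1), (2, - 1, 2), (- 1, - 2, 1), (1, 2, 1), (0, - 2, 1), (0, - 1, 0), (0, 2, - 1), (- 2, 1, 2), (0, 2, 1)]),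
    ([(1, 2), (3, 4), (6, 8)],
     [7, 6, 8, 4, 3, 5, 1, 0, 2, 9],
     [(- 2, - 1, 1), (1, 2, 2), (- 1, 1, 2), (0, 1, - 2), (0, - 1, - 2), (0, 0, 0), (- 1, - 2, 2), (2, 1, 1), (1, - 1, 2), (0, 0, - 1)]),
    ([(1, 5), (3, 4), (5, 6)],
     [8, 6, 7, 4, 3, 9, 1, 2, 0, 5],
     [(1, 1, 1), (- 1, - 2, - 2), (0, 2, - 1), (- 1, 1, 1), (1, - 1, 1), (2, - 1, 2), (1, 2, - 2), (0, - 2, - 1), (- 1, - 1, 1), (- 2, 1, 2)]),
    ([(0, 3), (0, 2), (0, 9), (1, 2)],
     [9, 2, 1, 8, 6, 7, 4, 5, 3, 0],
     [(1, 2, 1), (- 1, 1, - 1), (1, - 1, - 1), (1, 0, 1), (2, - 2, - 2), (- 1, 0, 0), (- 2, 2, - 2), (1, 0, 0), (- 1, 0, 1), (- 1, - 2, 1)]),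
    ([(0, 3), (0, 2), (1, 4), (4, 7)],
     [2, 9, 0, 8, 7, 6, 5, 4, 3, 1],
     [(2, - 2, 1), (0, - 1, - 1), (- 2, 2, 1), (- 2, - 2, 0), (1, - 1, 1), (- 2, 1, 2), (2, - 1, 2), (- 1, 1, 1), (2, 2, 0), (0, 1, - 1)]),
    ([(0, 3), (0, 2), (3, 4), (6, 8)],
     [9, 2, 1, 8, 6, 7, 4, 5, 3, 0],
     [(- 1, 0, 0), (0, - 1, - 1), (0, 1, - 1), (2, - 2, 1), (- 1, - 2, 2), (- 2, - 1, 0), (1, 2, 2), (2, 1, 0), (- 2, 2, 1), (1, 0, 0)]),
    ([(0, 3), (0, 4), (1, 4), (2, 6)],
     [9, 2, 1, 8, 6, 7, 4, 5, 3, 0],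
     [(0, - 1, - 1), (1, 2, 2), (- 1, - 2, 2), (- 1, 0, - 1), (2, 0, - 2), (2, 2, 1), (- 2, 0, - 2), (- 2, - 2, 1), (1, 0, - 1), (0, 1, - 1)]),
    ([(0, 3), (0, 4), (3, 4), (6, 8)],
     [9, 2, 1, 8, 6, 7, 4, 5, 3, 0],
     [(- 1, 0, 0), (- 1, 2, 2), (1, - 2, 2), (- 2, - 1, - 2), (2, - 1, 1), (- 1, - 2, 1), (- 2, 1, 1), (1, 2, 1), (2, 1, - 2), (1, 0, 0)]),
    ([(0, 3), (0, 6), (3, 4), (4, 7)],
     [6, 7, 8, 4, 3, 9, 0, 1, 2, 5],
     [(1, 0, 0), (- 2, 1, - 2), (- 2, - 1, 1), (- 1, 2, 2), (1, - 2, 2), (- 2, 0, 1), (- 1, 0, 0), (2, - 1, - 2), (2, 1, 1), (2, 0, 1)]),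
    ([(0, 3), (0, 9), (0, 2), (0, 4)],
     [9, 2, 1, 8, 6, 7, 4, 5, 3, 0],
     [(- 2, - 2, 2), (- 1, 2, 1), (1, - 2, 1), (- 1, 1, 1), (2, 1, - 1), (- 1, - 1, 0), (- 2, - 1, - 1), (1, 1, 0), (1, - 1, 1), (2, 2, 2)]),
    ([(0, 3), (1, 8), (4, 7), (0, 1)],
     [5, 9, 4, 7, 2, 0, 8, 3, 6, 1],
     [(1, - 1, 2), (2, - 1, 2), (2, 1, - 1), (2, 2, - 2), (- 2, - 1, - 1), (- 1, 1, 2), (0, 2, - 1), (- 2, - 2, - 2), (0, - 2, - 1), (- 2, 1, 2)]),
    ([(1, 5), (4, 7), (3, 4), (5, 8)],
     [6, 7, 8, 4, 3, 9, 0, 1, 2, 5],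
     [(0, 1, 1), (0, - 1, - 2), (- 2, 1, 2), (1, 1, 1), (- 1, - 1, 1), (2, - 2, 2), (0, - 1, 1), (0, 1, - 2), (2, - 1, 2), (- 2, 2, 2)]),
    ([(1, 8), (4, 7), (0, 1), (1, 4)],
     [5, 9, 4, 7, 2, 0, 8, 3, 6, 1],
     [(0, - 1, - 1), (- 1, 2, 1), (- 2, - 1, 2), (- 1, 0, 1), (2, 1, 2), (0, 1, - 1), (2, - 2, - 2), (1, 0, 1), (- 2, 2, - 2), (1, - 2, 1)]),
    ([(0, 3), (0, 2), (0, 9), (3, 4), (6, 8)],
     [9, 2, 1, 8, 6, 7, 4, 5, 3, 0],
     [(2, - 2, 0), (- 1, 0, 1), (1, 0, 1), (- 1, - 1, 2), (- 2, 1, - 1), (2, - 1, 0), (2, - 1, - 1), (- 2, 1, 0), (1, 1, 2), (- 2, 2, 0)]),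
    ([(0, 3), (0, 2), (1, 2), (3, 4), (6, 8)],
     [9, 2, 1, 8, 6, 7, 4, 5, 3, 0],
     [(- 1, 0, - 1), (- 2, 2, 1), (2, - 2, 1), (- 2, 0, - 2), (1, 1, 1), (0, - 2, 2), (- 1, - 1, 1), (0, 2, 2), (2, 0, - 2), (1, 0, - 1)]),
    ([(0, 3), (0, 2), (1, 4), (3, 4), (7, 8)],
     [2, 9, 0, 8, 7, 6, 5, 4, 3, 1],
     [(- 1, - 2, - 2), (1, 2, - 1), (1, 2, - 2), (1, - 1, 1), (2, - 2, 2), (0, - 1, 0), (0, 1, 0), (- 2, 2, 2), (- 1, 1, 1), (- 1, - 2, - 1)]),
    ([(0, 3), (0, 2), (3, 4), (4, 7), (7, 8)],
     [7, 6, 8, 4, 3, 5, 1, 0, 2, 9],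
     [(1, 2, - 1), (- 2, 1, - 1), (- 1, 2, - 2), (0, 1, 1), (0, - 1, 1), (0, 0, 2), (2, - 1, - 1), (- 1, - 2, - 1), (1, - 2, - 2), (0, 0, 0)]),
    ([(0, 3), (0, 4), (1, 2), (3, 4), (6, 8)],
     [9, 2, 1, 8, 6, 7, 4, 5, 3, 0],
     [(2, 0, 1), (- 2, - 1, 2), (2, 1, 2), (0, - 2, - 2), (- 2, - 1, - 1), (1, 0, - 1), (2, 1, - 1), (- 1, 0, - 1), (0, 2, - 2), (- 2, 0, 1)]),
    ([(0, 3), (0, 6), (1, 2), (1, 4), (7, 8)],
     [3, 6, 4, 0, 2, 5, 1, 8, 7, 9],
     [(- 1, - 1, 2), (1, 2, - 2), (2, - 2, - 2), (1, 1, 2), (- 2, 2, - 2), (0, 0, 0), (- 1, - 2, - 2), (- 1, 2, - 1), (1, - 2, - 1), (0, 0, 1)]),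
    ([(0, 3), (1, 7), (2, 6), (3, 5), (5, 8)],
     [6, 3, 4, 1, 2, 9, 0, 8, 7, 5],
     [(1, 1, 0), (- 2, - 2, 2), (- 2, - 1, - 1), (2, 2, 2), (2, 1, - 1), (0, - 1, - 1), (- 1, - 1, 0), (2, - 1, - 2), (- 2, 1, - 2), (0, 1, - 1)]),
    ([(0, 3), (3, 4), (4, 8), (6, 8), (5, 6)],
     [7, 3, 5, 1, 9, 2, 8, 0, 6, 4],
     [(- 1, 1, 0), (0, 2, - 2), (1, 1, 1), (0, - 2, - 2), (1, 2, 2), (- 1, - 1, 1), (1, 2, - 1), (1, - 1, 0), (- 1, - 2, - 1), (- 1, - 2, 2)]),
    ([(0, 6), (1, 5), (1, 8), (3, 4), (5, 6)],
     [8, 6, 7, 4, 3, 9, 1, 2, 0, 5],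
     [(0, 1, - 1), (2, - 2, - 2), (- 1, - 1, 1), (0, 2, - 2), (0, - 2, - 2), (2, 1, 0), (- 2, 2, - 2), (1, 1, 1), (0, - 1, - 1), (- 2, - 1, 0)]),
    ([(0, 3), (0, 2), (0, 6), (2, 5), (6, 8), (6, 9)],
     [6, 5, 8, 4, 3, 1, 0, 9, 2, 7],
     [(- 1, 2, - 2), (0, - 1, - 1), (- 2, - 2, 0), (2, 1, 1), (- 2, - 1, 1), (0, 1, - 1), (1, - 2, - 2), (1, - 2, 0), (2, 2, 0), (- 1, 2, 0)]),
    ([(0, 3), (0, 2), (0, 8), (1, 4), (2, 3), (4, 7)],
     [2, 9, 0, 8, 7, 6, 5, 4, 3, 1],
     [(- 2, 0, - 1), (- 1, 0, - 2), (2, 0, - 1), (0, - 2, 0), (- 1, 0, - 1), (1, - 1, 2), (- 1, 1, 2), (1, 0, - 1), (0, 2, 0), (1, 0, - 2)]),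
    ([(0, 3), (0, 2), (0, 9), (1, 2), (1, 4), (4, 7)],
     [2, 9, 0, 8, 7, 6, 5, 4, 3, 1],
     [(2, - 2, 2), (- 1, - 1, 1), (- 2, 2, 2), (0, - 1, - 2), (2, 2, 1), (- 1, 1, 1), (1, - 1, 1), (- 2, - 2, 1), (0, 1, - 2), (1, 1, 1)]),
    ([(0, 3), (0, 2), (0, 9), (1, 2), (1, 8), (2, 3)],
     [9, 2, 1, 8, 6, 7, 4, 5, 3, 0],
     [(- 2, 2, 2), (- 1, - 1, - 1), (1, 1, - 1), (0, 2, 2), (2, 1, - 2), (0, - 1, 1), (- 2, - 1, - 2), (0, 1, 1), (0, - 2, 2), (2, - 2, 2)]),
    ([(0, 3), (0, 2), (0, 9), (1, 2), (3, 4), (6, 8)],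
     [9, 2, 1, 8, 6, 7, 4, 5, 3, 0],
     [(2, 2, - 1), (- 1, 1, - 1), (1, - 1, - 1), (1, 0, 2), (0, - 2, - 2), (- 2, 1, 0), (0, 2, - 2), (2, - 1, 0), (- 1, 0, 2), (- 2, - 2, - 1)]),
    ([(0, 3), (0, 2), (1, 4), (3, 4), (5, 6), (7, 8)],
     [6, 2, 1, 4, 3, 7, 0, 5, 9, 8],
     [(0, 2, - 2), (0, - 1, - 1), (0, 1, - 1), (0, - 2, 1), (0, 2, 1), (1, - 2, 1), (0, - 2, - 2), (- 1, 2, 1), (- 2, - 1, 2), (2, 1, 2)]),
    ([(0, 3), (0, 2), (1, 4), (3, 4), (7, 8), (4, 7)],
     [2, 9, 0, 8, 7, 6, 5, 4, 3, 1],
     [(- 2, 0, 1), (- 1, - 1, - 1), (2, 0, 1), (- 2, - 2, - 2), (1, 0, 0), (1, 0, 2), (- 1, 0, 2), (- 1, 0, 0), (2, 2, - 2), (1, 1, - 1)]),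
    ([(0, 3), (0, 4), (1, 2), (0, 9), (3, 4), (6, 8)],
     [9, 2, 1, 8, 6, 7, 4, 5, 3, 0],
     [(1, 2, 1), (- 1, - 1, 2), (1, 1, 2), (- 1, 2, - 2), (- 2, - 1, 0), (0, 2, - 1), (2, 1, 0), (0, - 2, - 1), (1, - 2, - 2), (- 1, - 2, 1)]),
    ([(0, 3), (0, 9), (0, 2), (0, 4), (1, 7), (2, 5)],
     [9, 2, 1, 8, 6, 7, 4, 5, 3, 0],
     [(2, - 2, - 2), (1, - 1, 2), (- 1, 1, 2), (1, 2, 0), (0, - 1, 0), (- 2, 1, 1), (0, 1, 0), (2, - 1, 1), (- 1, - 2, 0), (- 2, 2, - 2)]),
    ([(0, 3), (1, 7), (2, 6), (3, 5), (5, 8), (7, 8)],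
     [6, 3, 4, 1, 2, 9, 0, 8, 7, 5],
     [(- 1, - 1, 0), (1, 2, - 2), (2, - 1, 2), (- 1, - 2, - 2), (- 2, 1, 2), (2, 1, 0), (1, 1, 0), (- 1, 2, 1), (1, - 2, 1), (- 2, - 1, 0)]),
    ([(0, 3), (1, 7), (4, 8), (4, 9), (3, 4), (0, 4)],
     [5, 3, 7, 1, 9, 0, 8, 2, 6, 4],
     [(2, - 1, 1), (2, - 1, - 2), (- 1, 1, 0), (- 2, 1, - 2), (0, - 2, 2), (- 2, 1, 1), (- 1, - 2, 2), (1, - 1, 0), (1, 2, 2), (0, 2, 2)]),
    ([(0, 3), (3, 4), (4, 8), (4, 9), (6, 8), (5, 6)],
     [7, 3, 5, 1, 9, 2, 8, 0, 6, 4],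
     [(1, - 2, 2), (2, 1, - 2), (1, 1, 1), (- 2, - 1, - 2), (2, 0, 1), (- 1, - 1, 1), (2, 2, - 2), (- 1, 2, 2), (- 2, - 2, - 2), (- 2, 0, 1)]),
    ([(0, 3), (0, 2), (0, 6), (2, 5), (2, 7), (3, 4), (6, 8)],
     [2, 9, 0, 8, 6, 5, 4, 7, 3, 1],
     [(- 2, 2, 2), (1, 2, 1), (2, - 2, 2), (0, 1, - 1), (2, - 1, 2), (0, 0, - 2), (- 2, 1, 2), (0, 0, 0), (0, - 1, - 1), (- 1, - 2, 1)]),
    ([(0, 3), (0, 2), (0, 6), (2, 5), (3, 4), (6, 8), (6, 9)],
     [6, 5, 8, 4, 3, 1, 0, 9, 2, 7],
     [(2, 0, 2), (0, - 1, 1), (1, - 2, 1), (- 2, 1, - 2), (2, - 1, - 2), (0, 1, 1), (- 2, 0, 2), (- 2, - 2, - 1), (- 1, 2, 1), (2, 2, - 1)]),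
    ([(0, 3), (0, 2), (1, 2), (3, 4), (4, 9), (6, 8), (0, 6)],
     [9, 2, 1, 8, 6, 7, 4, 5, 3, 0],
     [(1, 0, 0), (2, - 1, - 1), (- 2, 1, - 1), (2, 0, - 1), (- 2, 0, 1), (- 2, - 1, - 2), (2, 0, 1), (2, 1, - 2), (- 2, 0, - 1), (- 1, 0, 0)]),
    ([(0, 3), (0, 9), (0, 2), (0, 4), (1, 7), (2, 5), (1, 2)],
     [9, 2, 1, 6, 8, 7, 3, 5, 4, 0],
     [(- 2, 0, 1), (- 1, - 1, - 2), (1, 1, - 2), (- 2, - 2, 1), (2, 1, 0), (1, - 2, 2), (2, 2, 1), (- 1, 2, 2), (- 2, - 1, 0), (2, 0, 1)]),
    ([(0, 3), (0, 2), (1, 2)],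
     [9, 2, 1, 8, 6, 7, 4, 5, 3, 0],
     [(0, 1, 0), (2, 2, 0), (- 2, - 2, 0), (0, 3, 3), (2, - 1, - 1), (- 3, 1, - 2), (- 2, 1, - 1), (3, - 1, - 2), (0, - 3, 3), (0, - 1, 0)]),
    ([(0, 3), (0, 4), (1, 5), (2, 7)],
     [9, 2, 1, 8, 6, 7, 4, 5, 3, 0],
     [(3, 3, 1), (- 3, - 2, 3), (3, 2, 3), (2, 1, 1), (- 2, 3, - 1), (- 3, - 3, 2), (2, - 3, - 1), (3, 3, 2), (- 2, - 1, 1), (- 3, - 3, 1)]),
    ([(0, 3), (1, 5), (2, 6), (0, 2)],
     [2, 9, 0, 8, 7, 6, 5, 4, 3, 1],
     [(- 1, - 2, - 1), (3, 3, - 2), (1, 2, - 1), (2, - 2, - 1), (- 1, - 3, 3), (0, 1, 0), (0, - 1, 0), (1, 3, 3), (- 2, 2, - 1), (- 3, - 3, - 2)]),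
    ([(0, 3), (0, 2), (0, 8), (1, 2), (3, 9)],
     [9, 2, 1, 8, 6, 7, 4, 5, 3, 0],
     [(0, - 1, 0), (3, - 3, 3), (- 3, 3, 3), (1, - 2, 1), (- 1, - 2, - 2), (2, 3, - 3), (1, 2, - 2), (- 2, - 3, - 3), (- 1, 2, 1), (0, 1, 0)]),
    ([(0, 3), (0, 2), (0, 9), (1, 5), (2, 7)],
     [9, 2, 1, 8, 6, 7, 4, 5, 3, 0],
     [(1, 3, 0), (- 1, - 1, 0), (1, 1, 0), (- 3, 3, 1), (- 1, 0, - 3), (1, 1, - 1), (1, 0, - 3), (- 1, - 1, - 1), (3, - 3, 1), (- 1, - 3, 0)]),
    ([(0, 3), (0, 2), (0, 9), (1, 7), (2, 5)],
     [9, 2, 1, 8, 6, 7, 4, 5, 3, 0],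
     [(1, 1, 1), (- 2, 3, 2), (2, - 3, 2), (1, 2, 3), (- 1, 0, - 2), (3, 0, - 3), (1, 0, - 2), (- 3, 0, - 3), (- 1, - 2, 3), (- 1, - 1, 1)]),
    ([(0, 3), (0, 2), (1, 5), (2, 7), (1, 2)],
     [9, 2, 1, 8, 6, 7, 4, 5, 3, 0],
     [(- 2, 0, - 2), (3, 3, - 3), (- 3, - 3, - 3), (2, 1, - 2), (- 3, 1, 0), (- 3, 2, - 1), (3, - 1, 0), (3, - 2, - 1), (- 2, - 1, - 2), (2, 0, - 2)]),
    ([(0, 3), (1, 5), (2, 6), (0, 2), (5, 6)],
     [2, 9, 0, 8, 7, 6, 5, 4, 3, 1],
     [(3, 0, 3), (- 1, 2, - 1), (- 3, 0, 3), (0, 1, - 2), (1, 0, 2), (- 2, - 3, - 1), (2, 3, - 1), (- 1, 0, 2), (0, - 1, - 2), (1, - 2, - 1)]),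
    ([(0, 6), (1, 5), (4, 7), (3, 4), (5, 8)],
     [6, 7, 8, 4, 3, 9, 0, 1, 2, 5],
     [(3, - 3, - 2), (- 1, 0, 0), (3, 2, 3), (3, 1, 1), (- 3, - 1, 1), (0, - 3, - 1), (- 3, 3, - 2), (1, 0, 0), (- 3, - 2, 3), (0, 3, - 1)]),
    ([(0, 3), (0, 2), (3, 4), (4, 9), (6, 8), (0, 6)],
     [2, 9, 0, 8, 6, 5, 4, 7, 3, 1],
     [(2, 1, - 2), (- 1, 3, 0), (- 2, - 1, - 2), (0, 3, 1), (- 3, - 3, - 3), (0, 0, 3), (3, 3, - 3), (0, 0, - 1), (0, - 3, 1), (1, - 3, 0)]),
    ([(0, 3), (0, 8), (0, 1), (1, 5), (2, 6), (4, 8)],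
     [1, 0, 6, 5, 7, 3, 2, 4, 9, 8],
     [(- 1, 0, 0), (1, 0, 0), (0, 1, - 1), (2, 2, 0), (0, - 3, - 2), (- 2, - 2, 0), (0, - 1, - 1), (0, 3, - 2), (- 2, - 1, 2), (2, 1, 2)]),
    ([(0, 3), (0, 2), (1, 4), (5, 6)],
     [2, 9, 0, 8, 7, 6, 5, 4, 3, 1],
     [(- 3, - 1, - 4), (- 3, - 4, 2), (3, 1, - 4), (- 2, 3, 3), (- 1, 2, 4), (0, - 1, 2), (0, 1, 2), (1, - 2, 4), (2, - 3, 3), (3, 4, 2)]),
    ([(0, 3), (0, 2), (1, 7), (2, 5)],
     [9, 2, 1, 8, 6, 7, 4, 5, 3, 0],
     [(2, - 4, 0), (2, - 2, - 3), (- 2, 2, - 3), (- 3, - 4, 3), (1, 2, 2), (0, 3, 1), (- 1, - 2, 2), (0, - 3, 1), (3, 4, 3), (- 2, 4, 0)]),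
    ([(0, 3), (0, 2), (0, 8), (1, 4), (2, 3)],
     [2, 9, 0, 8, 7, 6, 5, 4, 3, 1],
     [(- 4, 0, 1), (- 3, 0, 4), (4, 0, 1), (- 1, - 4, 1), (- 1, 0, 0), (3, - 3, - 1), (- 3, 3, - 1), (1, 0, 0), (1, 4, 1), (3, 0, 4)]),
    ([(0, 3), (0, 2), (0, 9), (1, 2), (1, 4)],
     [2, 9, 0, 8, 7, 6, 5, 4, 3, 1],
     [(0, 4, 4), (1, - 1, 2), (0, - 4, 4), (3, 1, 1), (- 2, 1, - 1), (4, - 2, - 3), (- 4, 2, - 3), (2, - 1, - 1), (- 3, - 1, 1), (- 1, 1, 2)]),
    ([(0, 3), (0, 2), (0, 9), (1, 8), (2, 3)],
     [9, 2, 1, 8, 6, 7, 4, 5, 3, 0],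
     [(4, 4, 2), (1, 0, 1), (- 1, 0, 1), (4, - 4, 3), (1, - 4, - 3), (0, 2, 2), (- 1, 4, - 3), (0, - 2, 2), (- 4, 4, 3), (- 4, - 4, 2)]),
    ([(1, 2), (3, 7), (3, 4), (6, 7), (4, 7)],
     [5, 3, 4, 1, 2, 0, 8, 9, 6, 7],
     [(- 3, - 4, - 4), (- 2, - 2, - 2), (2, 1, - 2), (2, 2, - 2), (- 2, - 1, - 2), (3, 4, - 4), (2, - 2, 3), (4, 0, - 3), (- 2, 2, 3), (- 4, 0, - 3)]),
    ([(1, 5), (3, 4), (3, 9), (4, 5), (5, 6)],
     [8, 6, 7, 4, 3, 9, 1, 2, 0, 5],
     [(- 1, - 2, 0), (- 4, - 4, 1), (- 4, - 2, 2), (2, - 3, - 2), (- 2, 3, - 2), (2, - 1, - 4), (4, 4, 1), (4, 2, 2), (1, 2, 0), (- 2, 1, - 4)]),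
    ([(1, 7), (2, 6), (3, 5), (5, 8), (4, 5)],
     [6, 3, 4, 1, 2, 9, 0, 8, 7, 5],
     [(- 1, - 1, 1), (- 4, 2, - 3), (1, - 1, - 2), (4, - 2, - 3), (- 1, 1, - 2), (4, 2, - 3), (1, 1, 1), (2, 4, 0), (- 2, - 4, 0), (- 4, - 2, - 3)]),
    ([(0, 3), (1, 8), (3, 7), (6, 7), (4, 7), (0, 1)],
     [5, 9, 4, 7, 2, 0, 8, 3, 6, 1],
     [(2, - 2, - 1), (- 4, 3, - 1), (- 3, 4, - 3), (4, - 2, 3), (3, - 4, - 3), (- 2, 2, - 1), (- 3, 0, 0), (- 4, 2, 3), (3, 0, 0), (4, - 3, - 1)]),
    ([(0, 3), (0, 2), (1, 5), (2, 7)],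
     [9, 2, 1, 8, 6, 7, 4, 5, 3, 0],
     [(- 2, - 1, 1), (4, - 6, - 4), (- 4, 6, - 4), (- 5, - 5, 5), (1, - 2, - 1), (- 6, 3, - 5), (- 1, 2, - 1), (6, - 3, - 5), (5, 5, 5), (2, 1, 1)]),
    ([(0, 3), (0, 2), (0, 8), (0, 9), (1, 2), (3, 9)],
     [9, 2, 1, 8, 6, 7, 4, 5, 3, 0],
     [(6, 1, 0), (0, 3, 4), (0, - 3, 4), (0, 6, 6), (- 6, 2, - 4), (2, 0, 0), (6, - 2, - 4), (- 2, 0, 0), (0, - 6, 6), (- 6, - 1, 0)]),
    ([(0, 3), (0, 4), (0, 6), (4, 9)],
     [9, 2, 1, 8, 6, 7, 4, 5, 3, 0],
     [(14, 1, 14), (- 1, 4, 2), (1, - 4, 2), (- 9, 8, - 6), (- 3, - 4, 9), (5, - 5, - 4), (3, 4, 9), (- 5, 5, - 4), (9, - 8, - 6), (- 14, - 1, 14)]),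
    ([(0, 3), (0, 2), (0, 8), (0, 9), (3, 9)],
     [9, 2, 1, 8, 6, 7, 4, 5, 3, 0],
     [(16, - 19, - 2), (- 5, - 5, - 15), (5, 5, - 15), (- 14, - 11, - 20), (- 20, 5, 15), (12, - 4, 7), (20, - 5, 15), (- 12, 4, 7), (14, 11, - 20), (- 16, 19, - 2)]),
    ([(0, 3), (0, 9), (4, 7), (3, 4)],
     [7, 6, 8, 4, 3, 5, 1, 0, 2, 9],
     [(- 23, - 28, 14), (7, - 8, - 14), (- 10, 7, - 21), (3, - 22, - 6), (- 3, 22, - 6), (0, 0, - 13), (- 7, 8, - 14), (23, 28, 14), (10, - 7, - 21), (0, 0, - 29)])]"

text \<open>Evaluation is by rewriting inside the logic. The determinants are exact integers, so
  their signs are decided without rounding.\<close>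

lemma valid_mirror_surfaces: "list_all (valid True) mirror_surfaces"
  by code_simp

lemma valid_turn_surfaces: "list_all (valid False) turn_surfaces"
  by code_simp

lemma distinct_dual_weights:
  "distinct (map (\<lambda>d. dual_weight_list (triangles_of d)) (mirror_surfaces @ turn_surfaces))"
  by code_simp

theorem theorem5p3:
  fixes T :: "nat set set set set"
  defines "T \<equiv> triangulation_classes klein_bottle 10"
  assumes known_enumeration: "card T = 4462"
  shows "card {c \<in> T. \<exists>g. involutory g \<and> realizes_symmetry c g} \<ge> 76 \<and>
    (\<exists>S \<subseteq> T. \<exists>g :: nat set set set \<Rightarrow> real^3 \<Rightarrow> real^3.
       card S = 76 \<and>
       (\<forall>c\<in>S. involutory (g c) \<and> realizes_symmetry c (g c)) \<and>
       2 * card {c \<in> S. rotation (g c)} > card S \<and>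
       card {c \<in> S. plane_reflection (g c)} = 9)"
proof
  have "length mirror_surfaces = 9" "length turn_surfaces = 67"
    by (simp_all add: mirror_surfaces_def turn_surfaces_def)
  then show main: "\<exists>S \<subseteq> T. \<exists>g :: nat set set set \<Rightarrow> real^3 \<Rightarrow> real^3.
       card S = 76 \<and>
       (\<forall>c\<in>S. involutory (g c) \<and> realizes_symmetry c (g c)) \<and>
       2 * card {c \<in> S. rotation (g c)} > card S \<and>
       card {c \<in> S. plane_reflection (g c)} = 9"
    unfolding T_def using valid_mirror_surfaces valid_turn_surfaces distinct_dual_weights
    by (intro symmetric_realizations)
  \<comment> \<open>An infinite set has cardinality 0 by convention; the known nonzero count gives
    the finiteness under which a subset of size 76 bounds the cardinality from below.\<close>
  have "finite T" using known_enumeration card.infinite by fastforce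
  moreover obtain S where "S \<subseteq> {c \<in> T. \<exists>g. involutory g \<and> realizes_symmetry c g}" "card S = 76"
    using main by blast
  ultimately show "76 \<le> card {c \<in> T. \<exists>g. involutory g \<and> realizes_symmetry c g}"
    using card_mono[of "{c \<in> T. \<exists>g. involutory g \<and> realizes_symmetry c g}" S] by simp
qed

end
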